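(* Let $R$ be a commutative ring with unit, let $i\in\{1,\dots,6\}$, and let $(M,\Delta)$ be a $G_i$-coalgebra over $R$. Then the dual $M^{*}=Hom_R(M,R)$ of the $R$-module $M$ is naturally endowed with a $G_i$-associative algebra structure; that is, the multiplication $\mu : M^*\otimes M^*\to M^*$ defined by $$\mu(f_1\otimes f_2)=\mu_R\circ\lambda_2(f_1\otimes f_2)\circ\Delta$$ is $G_i$-associative.
   Context: All tensor products are over $R$. $\Sigma_3$ is the symmetric group on $\{1,2,3\}$, $(-1)^{\epsilon(\sigma)}$ is the sign of $\sigma$, $\tau_{jk}$ is the transposition exchanging $j$ and $k$, and $c_1,c_2$ are the two $3$-cycles. The subgroups of $\Sigma_3$ are denoted $G_1=\{Id\}$, $G_2=\{Id,\tau_{12}\}$, $G_3=\{Id,\tau_{23}\}$, $G_4=\{Id,\tau_{13}\}$, $G_5=\{Id,c_1,c_2\}$, $G_6=\Sigma_3$. For an $R$-module $N$ and $\sigma\in\Sigma_3$, $\Phi^N_\sigma : N^{\otimes 3}\to N^{\otimes 3}$ is the linear map with $\Phi^N_\sigma(x_1\otimes x_2\otimes x_3)=x_{\sigma^{-1}(1)}\otimes x_{\sigma^{-1}(2)}\otimes x_{\sigma^{-1}(3)}$, and $\Phi^N_{G_i}=\sum_{\sigma\in G_i}(-1)^{\epsilon(\sigma)}\Phi^N_\sigma$. A $G_i$-coalgebra is an $R$-module $M$ with an $R$-linear map $\Delta : M\to M\otimes M$ such that $\sum_{\sigma\in G_i}(-1)^{\epsilon(\sigma)}\Phi^M_\sigma\circ\tilde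 A(\Delta)=0$, where $\tilde A(\Delta)=(\Delta\otimes Id)\circ\Delta-(Id\otimes\Delta)\circ\Delta$. A multiplication $\mu : N\otimes N\to N$ ($R$-linear) on an $R$-module $N$ is $G_i$-associative if $A(\mu)\circ\Phi^N_{G_i}=0$, where $A(\mu)=\mu\circ(\mu\otimes Id)-\mu\circ(Id\otimes\mu)$; then $(N,\mu)$ is a $G_i$-associative algebra. No unit is required. $\mu_R : R\otimes R\to R$ is the multiplication of $R$, and $\lambda_2 : Hom(M,R)^{\otimes 2}\to Hom(M^{\otimes 2},R^{\otimes 2})$ is the natural map $\lambda_2(f_1\otimes f_2)(x_1\otimes x_2)=f_1(x_1)\otimes f_2(x_2)$. *)

theory Defs
  imports "HOL-Algebra.Module" "HOL-Algebra.AbelCoset" "HOL-Combinatorics.Permutations"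
begin

section \<open>Modules of linear maps\<close>

text \<open>
  An \<open>R\<close>-linear map is represented by an extensional function on the carrier of its domain, so that
  equality of linear maps is equality in HOL.  The fields \<open>mult\<close> and \<open>one\<close> of a module record play
  no role in the \<open>module\<close> locale and are left unspecified.
\<close>

definition lin_hom ::
    "('r, 'x) ring_scheme \<Rightarrow> ('r, 'm, 'y) module_scheme \<Rightarrow> ('r, 'n, 'z) module_scheme \<Rightarrow> ('m \<Rightarrow> 'n) set"
  where "lin_hom R M N = {f \<in> carrier M \<rightarrow>\<^sub>E carrier N.
     (\<forall>x\<in>carrier M. \<forall>y\<in>carrier M. f (x \<oplus>\<^bsub>M\<^esub> y) = f x \<oplus>\<^bsub>N\<^esub> f y) \<and>
     (\<forall>a\<in>carrier R. \<forall>x\<in>carrier M. f (a \<odot>\<^bsub>M\<^esub> x) = a \<odot>\<^bsub>N\<^esub> f x)}"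

definition hom_module ::
    "('r, 'x) ring_scheme \<Rightarrow> ('r, 'm, 'y) module_scheme \<Rightarrow> ('r, 'n, 'z) module_scheme
      \<Rightarrow> ('r, 'm \<Rightarrow> 'n) module"
  where "hom_module R M N =
    \<lparr>carrier = lin_hom R M N, monoid.mult = undefined, one = undefined,
     zero = (\<lambda>x\<in>carrier M. \<zero>\<^bsub>N\<^esub>),
     add = (\<lambda>f g. \<lambda>x\<in>carrier M. f x \<oplus>\<^bsub>N\<^esub> g x),
     smult = (\<lambda>a f. \<lambda>x\<in>carrier M. a \<odot>\<^bsub>N\<^esub> f x)\<rparr>"

definition regular_module :: "('r, 'x) ring_scheme \<Rightarrow> ('r, 'r) module"
  where "regular_module R =
    \<lparr>carrier = carrier R, monoid.mult = monoid.mult R, one = one R, zero = zero R, add = add R, smult = monoid.mult R\<rparr>"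

definition dual_module :: "('r, 'x) ring_scheme \<Rightarrow> ('r, 'm, 'y) module_scheme \<Rightarrow> ('r, 'm \<Rightarrow> 'r) module"
  where "dual_module R M = hom_module R M (regular_module R)"

definition id_hom :: "('r, 'm, 'y) module_scheme \<Rightarrow> 'm \<Rightarrow> 'm"
  where "id_hom M = (\<lambda>x\<in>carrier M. x)"

definition the_hom ::
    "('r, 'x) ring_scheme \<Rightarrow> ('r, 'm, 'y) module_scheme \<Rightarrow> ('r, 'n, 'z) module_scheme
      \<Rightarrow> (('m \<Rightarrow> 'n) \<Rightarrow> bool) \<Rightarrow> 'm \<Rightarrow> 'n"
  where "the_hom R M N P = (THE h. h \<in> lin_hom R M N \<and> P h)"


section \<open>The tensor product of two modules\<close>

definition free_module :: "('r, 'x) ring_scheme \<Rightarrow> 's set \<Rightarrow> ('r, 's \<Rightarrow> 'r) module"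
  where "free_module R S =
    \<lparr>carrier = {u. (\<forall>s. u s \<in> carrier R) \<and> (\<forall>s. s \<notin> S \<longrightarrow> u s = \<zero>\<^bsub>R\<^esub>) \<and> finite {s. u s \<noteq> \<zero>\<^bsub>R\<^esub>}},
     monoid.mult = undefined, one = undefined,
     zero = (\<lambda>s. \<zero>\<^bsub>R\<^esub>),
     add = (\<lambda>u v s. u s \<oplus>\<^bsub>R\<^esub> v s),
     smult = (\<lambda>a u s. a \<otimes>\<^bsub>R\<^esub> u s)\<rparr>"

definition free_gen :: "('r, 'x) ring_scheme \<Rightarrow> 's \<Rightarrow> 's \<Rightarrow> 'r"
  where "free_gen R s = (\<lambda>t. if t = s then \<one>\<^bsub>R\<^esub> else \<zero>\<^bsub>R\<^esub>)"

definition submodule_span ::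
    "('r, 'x) ring_scheme \<Rightarrow> ('r, 'm, 'y) module_scheme \<Rightarrow> 'm set \<Rightarrow> 'm set"
  where "submodule_span R M B = \<Inter>{H. submodule H R M \<and> B \<subseteq> H}"

definition quotient_module ::
    "('r, 'm, 'y) module_scheme \<Rightarrow> 'm set \<Rightarrow> ('r, 'm set) module"
  where "quotient_module M H =
    \<lparr>carrier = a_rcosets\<^bsub>M\<^esub> H, monoid.mult = undefined, one = undefined,
     zero = H, add = set_add M,
     smult = (\<lambda>a C. \<Union>x\<in>C. H +>\<^bsub>M\<^esub> (a \<odot>\<^bsub>M\<^esub> x))\<rparr>"

definition tensor_relations ::
    "('r, 'x) ring_scheme \<Rightarrow> ('r, 'm, 'y) module_scheme \<Rightarrow> ('r, 'n, 'z) module_scheme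
      \<Rightarrow> ('m \<times> 'n \<Rightarrow> 'r) set"
  where "tensor_relations R M N =
    (let F = free_module R (carrier M \<times> carrier N) in
      {free_gen R (x \<oplus>\<^bsub>M\<^esub> x', y) \<ominus>\<^bsub>F\<^esub> (free_gen R (x, y) \<oplus>\<^bsub>F\<^esub> free_gen R (x', y)) | x x' y.
         x \<in> carrier M \<and> x' \<in> carrier M \<and> y \<in> carrier N} \<union>
      {free_gen R (x, y \<oplus>\<^bsub>N\<^esub> y') \<ominus>\<^bsub>F\<^esub> (free_gen R (x, y) \<oplus>\<^bsub>F\<^esub> free_gen R (x, y')) | x y y'.
         x \<in> carrier M \<and> y \<in> carrier N \<and> y' \<in> carrier N} \<union>
      {free_gen R (a \<odot>\<^bsub>M\<^esub> x, y) \<ominus>\<^bsub>F\<^esub> (a \<odot>\<^bsub>F\<^esub> free_gen R (x, y)) | a x y.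
         a \<in> carrier R \<and> x \<in> carrier M \<and> y \<in> carrier N} \<union>
      {free_gen R (x, a \<odot>\<^bsub>N\<^esub> y) \<ominus>\<^bsub>F\<^esub> (a \<odot>\<^bsub>F\<^esub> free_gen R (x, y)) | a x y.
         a \<in> carrier R \<and> x \<in> carrier M \<and> y \<in> carrier N})"

definition tensor_kernel ::
    "('r, 'x) ring_scheme \<Rightarrow> ('r, 'm, 'y) module_scheme \<Rightarrow> ('r, 'n, 'z) module_scheme
      \<Rightarrow> ('m \<times> 'n \<Rightarrow> 'r) set"
  where "tensor_kernel R M N =
    submodule_span R (free_module R (carrier M \<times> carrier N)) (tensor_relations R M N)"

definition tensor_product ::
    "('r, 'x) ring_scheme \<Rightarrow> ('r, 'm, 'y) module_scheme \<Rightarrow> ('r, 'n, 'z) module_scheme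
      \<Rightarrow> ('r, ('m \<times> 'n \<Rightarrow> 'r) set) module"
  where "tensor_product R M N =
    quotient_module (free_module R (carrier M \<times> carrier N)) (tensor_kernel R M N)"

definition tensor_elt ::
    "('r, 'x) ring_scheme \<Rightarrow> ('r, 'm, 'y) module_scheme \<Rightarrow> ('r, 'n, 'z) module_scheme
      \<Rightarrow> 'm \<Rightarrow> 'n \<Rightarrow> ('m \<times> 'n \<Rightarrow> 'r) set"
  where "tensor_elt R M N x y =
    tensor_kernel R M N +>\<^bsub>free_module R (carrier M \<times> carrier N)\<^esub> free_gen R (x, y)"

text \<open>
  The tensor product is a module with the expected universal property, so a linear map out of it may
  be specified by \<open>the_hom\<close> through its values on the elements \<open>x \<otimes> y\<close>.
\<close>

lemma lin_homI:
  assumes "f \<in> carrier M \<rightarrow>\<^sub>E carrier N"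
   "\<And>x y. x\<in>carrier M \<Longrightarrow> y\<in>carrier M \<Longrightarrow> f (x \<oplus>\<^bsub>M\<^esub> y) = f x \<oplus>\<^bsub>N\<^esub> f y"
   "\<And>a x. a\<in>carrier R \<Longrightarrow> x\<in>carrier M \<Longrightarrow> f (a \<odot>\<^bsub>M\<^esub> x) = a \<odot>\<^bsub>N\<^esub> f x"
  shows "f \<in> lin_hom R M N"
  using assms unfolding lin_hom_def by blast

lemma module_hom_module:
  assumes "module R M" "module R N"
  shows "module R (hom_module R M N)"
proof -
  interpret M: module R M by fact
  interpret N: module R N by fact
  show ?thesis
  proof (rule moduleI)
    show "cring R" by (rule M.R.is_cring)
    show "abelian_group (hom_module R M N)"
    proof (rule abelian_groupI)
      fix f assume f: "f \<in> carrier (hom_module R M N)"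
      let ?g = "\<lambda>x\<in>carrier M. \<ominus>\<^bsub>N\<^esub> f x"
      have "?g \<in> carrier (hom_module R M N)"
        using f unfolding hom_module_def
        by (auto simp: lin_hom_def PiE_iff N.minus_add N.smult_r_minus N.add.m_comm)
      moreover have "?g \<oplus>\<^bsub>hom_module R M N\<^esub> f = \<zero>\<^bsub>hom_module R M N\<^esub>"
        using f by (auto simp: hom_module_def lin_hom_def PiE_iff N.l_neg fun_eq_iff restrict_def)
      ultimately show "\<exists>y\<in>carrier (hom_module R M N). y \<oplus>\<^bsub>hom_module R M N\<^esub> f = \<zero>\<^bsub>hom_module R M N\<^esub>" by blast
    qed (auto simp: hom_module_def lin_hom_def PiE_iff N.smult_r_distr
          N.a_ac restrict_def fun_eq_iff extensional_def)
  qed (auto simp: hom_module_def lin_hom_def PiE_iff N.smult_r_distr N.smult_l_distr N.smult_assoc1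
        N.a_ac restrict_def fun_eq_iff extensional_def 
        simp flip: N.smult_assoc1 simp: M.R.m_comm)
qed

lemma module_regular: fixes R (structure) shows "cring R \<Longrightarrow> module R (regular_module R)"
proof -
  assume "cring R"
  then interpret cring R .
  show ?thesis
  proof (rule moduleI)
    show "abelian_group (regular_module R)"
      by (rule abelian_groupI) (auto simp: regular_module_def a_ac intro: bexI[of _ "\<ominus> x" for x] l_neg)
  qed (auto simp: regular_module_def l_distr r_distr m_assoc is_cring)
qed

lemma module_free: fixes R (structure) assumes "cring R" shows "module R (free_module R S)"
proof -
  interpret cring R by fact
  have fin: "finite {s. u s \<oplus> v s \<noteq> \<zero>}" if "finite {s. u s \<noteq> \<zero>}" "finite {s. v s \<noteq> \<zero>}" for u v
    by (rule finite_subset[OF _ finite_UnI[OF that]]) auto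
  have fin2: "finite {s. a \<otimes> u s \<noteq> \<zero>}" if "finite {s. u s \<noteq> \<zero>}" "a \<in> carrier R" for u a
    by (rule finite_subset[OF _ that(1)]) (use that in auto)
  have fin3: "finite {s. \<ominus> u s \<noteq> \<zero>}" if "finite {s. u s \<noteq> \<zero>}" for u
    by (rule finite_subset[OF _ that(1)])  auto
  show ?thesis
  proof (rule moduleI)
    show "abelian_group (free_module R S)"
    proof (rule abelian_groupI)
      fix u assume u: "u \<in> carrier (free_module R S)"
      then show "\<exists>y\<in>carrier (free_module R S). y \<oplus>\<^bsub>free_module R S\<^esub> u = \<zero>\<^bsub>free_module R S\<^esub>"
        by (intro bexI[of _ "\<lambda>s. \<ominus> u s"]) (auto simp: free_module_def fin3 l_neg)
    qed (auto simp: free_module_def fin a_ac)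
  qed (auto simp: free_module_def fin fin2 l_distr r_distr m_assoc is_cring)
qed

lemma submodule_span: assumes "module R M" "B \<subseteq> carrier M"
  shows "submodule (submodule_span R M B) R M" "B \<subseteq> submodule_span R M B"
proof -
  interpret module R M by fact
  show "submodule (submodule_span R M B) R M"
  proof (rule submoduleI)
    show "submodule_span R M B \<subseteq> carrier M"
      using carrier_is_submodule assms(2) unfolding submodule_span_def by blast
  qed (use submoduleE in \<open>auto simp: submodule_span_def subgroup.one_closed submodule_def dest: subgroup.one_closed subgroup.m_closed\<close>)
  show "B \<subseteq> submodule_span R M B" unfolding submodule_span_def by blast
qed

lemma module_quotient: assumes "module R M" "submodule H R M"
  shows "module R (quotient_module M H)"
   and "\<And>x. x \<in> carrier M \<Longrightarrow> H +>\<^bsub>M\<^esub> x \<in> carrier (quotient_module M H)"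
   and "\<And>x y. x \<in> carrier M \<Longrightarrow> y \<in> carrier M \<Longrightarrow> (H +>\<^bsub>M\<^esub> x) \<oplus>\<^bsub>quotient_module M H\<^esub> (H +>\<^bsub>M\<^esub> y) = H +>\<^bsub>M\<^esub> (x \<oplus>\<^bsub>M\<^esub> y)"
   and "\<And>x a. x \<in> carrier M \<Longrightarrow> a \<in> carrier R \<Longrightarrow> a \<odot>\<^bsub>quotient_module M H\<^esub> (H +>\<^bsub>M\<^esub> x) = H +>\<^bsub>M\<^esub> (a \<odot>\<^bsub>M\<^esub> x)"
proof -
  interpret module R M by fact
  interpret H: submodule H R M by fact
  interpret HS: additive_subgroup H M by unfold_locales
  interpret HA: abelian_subgroup H M
    by (rule abelian_subgroupI3) (unfold_locales)
  let ?Q = "quotient_module M H"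
  show c: "H +>\<^bsub>M\<^esub> x \<in> carrier (quotient_module M H)" if "x \<in> carrier M" for x
    using that unfolding quotient_module_def A_RCOSETS_def' by auto
  have cE: "\<exists>x\<in>carrier M. C = H +>\<^bsub>M\<^esub> x" if "C \<in> carrier (quotient_module M H)" for C
    using that unfolding quotient_module_def A_RCOSETS_def' by auto
  show p: "(H +>\<^bsub>M\<^esub> x) \<oplus>\<^bsub>quotient_module M H\<^esub> (H +>\<^bsub>M\<^esub> y) = H +>\<^bsub>M\<^esub> (x \<oplus>\<^bsub>M\<^esub> y)" if "x \<in> carrier M" "y \<in> carrier M" for x y
    using that unfolding quotient_module_def by (simp add: HA.a_rcos_sum)
  show s: "a \<odot>\<^bsub>quotient_module M H\<^esub> (H +>\<^bsub>M\<^esub> x) = H +>\<^bsub>M\<^esub> (a \<odot>\<^bsub>M\<^esub> x)" if "x \<in> carrier M" "a \<in> carrier R" for x a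
  proof -
    have "H +>\<^bsub>M\<^esub> (a \<odot>\<^bsub>M\<^esub> x') = H +>\<^bsub>M\<^esub> (a \<odot>\<^bsub>M\<^esub> x)" if x': "x' \<in> H +>\<^bsub>M\<^esub> x" for x'
    proof -
      obtain h where h: "h \<in> H" "x' = h \<oplus>\<^bsub>M\<^esub> x" using x' unfolding a_r_coset_def' by blast
      have hM: "h \<in> carrier M" using h(1) HS.a_subset by blast
      have "a \<odot>\<^bsub>M\<^esub> x' = a \<odot>\<^bsub>M\<^esub> h \<oplus>\<^bsub>M\<^esub> a \<odot>\<^bsub>M\<^esub> x"
        unfolding h(2) by (rule smult_r_distr[OF \<open>a \<in> carrier R\<close> hM \<open>x \<in> carrier M\<close>])
      moreover have "a \<odot>\<^bsub>M\<^esub> h \<in> H" by (rule H.smult_closed[OF \<open>a \<in> carrier R\<close> h(1)])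
      ultimately have "a \<odot>\<^bsub>M\<^esub> x' \<in> H +>\<^bsub>M\<^esub> (a \<odot>\<^bsub>M\<^esub> x)" unfolding a_r_coset_def' by blast
      then show ?thesis
        using M.a_repr_independence'[of "a \<odot>\<^bsub>M\<^esub> x'" H "a \<odot>\<^bsub>M\<^esub> x", folded a_r_coset_def]
          \<open>a \<in> carrier R\<close> \<open>x \<in> carrier M\<close> H.subgroup_axioms by simp
    qed
    moreover have "x \<in> H +>\<^bsub>M\<^esub> x" using that HA.a_rcos_self by simp
    ultimately have "(\<Union>x'\<in>H +>\<^bsub>M\<^esub> x. H +>\<^bsub>M\<^esub> (a \<odot>\<^bsub>M\<^esub> x')) = H +>\<^bsub>M\<^esub> (a \<odot>\<^bsub>M\<^esub> x)" by blast
    then show ?thesis unfolding quotient_module_def by simp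
  qed
  have z: "\<zero>\<^bsub>?Q\<^esub> = H +>\<^bsub>M\<^esub> \<zero>\<^bsub>M\<^esub>"
    using M.a_coset_add_zero[OF HS.a_subset] by (simp add: quotient_module_def)
  have ag: "abelian_group ?Q"
  proof (rule abelian_groupI)
    fix C assume "C \<in> carrier ?Q"
    then obtain x where "x \<in> carrier M" "C = H +>\<^bsub>M\<^esub> x" using cE by blast
    then show "\<exists>D\<in>carrier ?Q. D \<oplus>\<^bsub>?Q\<^esub> C = \<zero>\<^bsub>?Q\<^esub>"
      by (intro bexI[of _ "H +>\<^bsub>M\<^esub> (\<ominus>\<^bsub>M\<^esub> x)"]) (auto simp: p c z M.l_neg)
  qed (auto dest!: cE simp: p c z M.a_ac)
  show "module R ?Q"
  proof (rule moduleI)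
    show "cring R" by (rule R.is_cring)
    show "abelian_group ?Q" by (rule ag)
  qed (auto dest!: cE simp: c p s smult_l_distr smult_r_distr smult_assoc1)
qed

definition bilinear_map ::
    "('r, 'x) ring_scheme \<Rightarrow> ('r, 'm, 'y) module_scheme \<Rightarrow> ('r, 'n, 'z) module_scheme
      \<Rightarrow> ('r, 'p, 'w) module_scheme \<Rightarrow> ('m \<Rightarrow> 'n \<Rightarrow> 'p) \<Rightarrow> bool"
  where "bilinear_map R M N P f \<longleftrightarrow>
   (\<forall>x\<in>carrier M. \<forall>y\<in>carrier N. f x y \<in> carrier P) \<and>
   (\<forall>x\<in>carrier M. \<forall>x'\<in>carrier M. \<forall>y\<in>carrier N. f (x \<oplus>\<^bsub>M\<^esub> x') y = f x y \<oplus>\<^bsub>P\<^esub> f x' y) \<and>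
   (\<forall>x\<in>carrier M. \<forall>y\<in>carrier N. \<forall>y'\<in>carrier N. f x (y \<oplus>\<^bsub>N\<^esub> y') = f x y \<oplus>\<^bsub>P\<^esub> f x y') \<and>
   (\<forall>a\<in>carrier R. \<forall>x\<in>carrier M. \<forall>y\<in>carrier N. f (a \<odot>\<^bsub>M\<^esub> x) y = a \<odot>\<^bsub>P\<^esub> f x y) \<and>
   (\<forall>a\<in>carrier R. \<forall>x\<in>carrier M. \<forall>y\<in>carrier N. f x (a \<odot>\<^bsub>N\<^esub> y) = a \<odot>\<^bsub>P\<^esub> f x y)"

lemma free_gen_closed: fixes R (structure) shows "cring R \<Longrightarrow> s \<in> S \<Longrightarrow> free_gen R s \<in> carrier (free_module R S)"
proof -
  assume "cring R" "s \<in> S"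
  then interpret cring R by simp
  have "finite {t. (if t = s then \<one> else \<zero>) \<noteq> \<zero>}" by (rule finite_subset[of _ "{s}"]) auto
  then show ?thesis using \<open>s \<in> S\<close> by (auto simp: free_gen_def free_module_def)
qed

lemma free_lift:
  assumes "module R P" "f \<in> S \<rightarrow> carrier P"
  obtains L where "\<And>u. u \<in> carrier (free_module R S) \<Longrightarrow> L u \<in> carrier P"
    "\<And>u v. u \<in> carrier (free_module R S) \<Longrightarrow> v \<in> carrier (free_module R S) \<Longrightarrow> L (u \<oplus>\<^bsub>free_module R S\<^esub> v) = L u \<oplus>\<^bsub>P\<^esub> L v"
    "\<And>a u. a \<in> carrier R \<Longrightarrow> u \<in> carrier (free_module R S) \<Longrightarrow> L (a \<odot>\<^bsub>free_module R S\<^esub> u) = a \<odot>\<^bsub>P\<^esub> L u"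
    "\<And>s. s \<in> S \<Longrightarrow> L (free_gen R s) = f s"
proof -
  interpret P: module R P by fact
  let ?F = "free_module R S"
  define g where "g = (\<lambda>u s. if s \<in> S then u s \<odot>\<^bsub>P\<^esub> f s else \<zero>\<^bsub>P\<^esub>)"
  define L where "L = (\<lambda>u. finsum P (g u) {s. u s \<noteq> \<zero>\<^bsub>R\<^esub>})"
  have gc: "g u s \<in> carrier P" if "u \<in> carrier ?F" for u s
    using that assms(2) by (auto simp: g_def free_module_def)
  have Leq: "L u = finsum P (g u) A" if "u \<in> carrier ?F" "finite A" "{s. u s \<noteq> \<zero>\<^bsub>R\<^esub>} \<subseteq> A" for u A
    unfolding L_def
    by (rule P.add.finprod_mono_neutral_cong_left) (use that assms(2) gc in \<open>auto simp: g_def Pi_iff\<close>)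
  have fin: "finite {s. u s \<noteq> \<zero>\<^bsub>R\<^esub>}" if "u \<in> carrier ?F" for u using that by (auto simp: free_module_def)
  interpret F: module R ?F by (rule module_free) (rule P.R.is_cring)
  show ?thesis
  proof (rule that[of L])
    show Lc: "L u \<in> carrier P" if "u \<in> carrier ?F" for u
      unfolding L_def using that gc by (auto intro!: P.finsum_closed)
    show "L (u \<oplus>\<^bsub>?F\<^esub> v) = L u \<oplus>\<^bsub>P\<^esub> L v" if "u \<in> carrier ?F" "v \<in> carrier ?F" for u v
    proof -
      let ?A = "{s. u s \<noteq> \<zero>\<^bsub>R\<^esub>} \<union> {s. v s \<noteq> \<zero>\<^bsub>R\<^esub>}"
      have A: "finite ?A" using fin that by auto
      have "L (u \<oplus>\<^bsub>?F\<^esub> v) = finsum P (g (u \<oplus>\<^bsub>?F\<^esub> v)) ?A"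
        by (rule Leq) (use A that F.a_closed in \<open>auto simp: free_module_def\<close>)
      also have "\<dots> = finsum P (\<lambda>s. g u s \<oplus>\<^bsub>P\<^esub> g v s) ?A"
        by (rule P.finsum_cong') (use that assms(2) gc in \<open>auto simp: g_def free_module_def Pi_iff P.smult_l_distr\<close>)
      also have "\<dots> = finsum P (g u) ?A \<oplus>\<^bsub>P\<^esub> finsum P (g v) ?A"
        by (rule P.finsum_addf) (use that gc in auto)
      also have "\<dots> = L u \<oplus>\<^bsub>P\<^esub> L v" using Leq[OF that(1) A] Leq[OF that(2) A] by simp
      finally show ?thesis .
    qed
    show "L (a \<odot>\<^bsub>?F\<^esub> u) = a \<odot>\<^bsub>P\<^esub> L u" if "a \<in> carrier R" "u \<in> carrier ?F" for a u
    proof -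
      let ?A = "{s. u s \<noteq> \<zero>\<^bsub>R\<^esub>}"
      have "L (a \<odot>\<^bsub>?F\<^esub> u) = finsum P (g (a \<odot>\<^bsub>?F\<^esub> u)) ?A"
        by (rule Leq) (use fin that F.smult_closed in \<open>auto simp: free_module_def\<close>)
      also have "\<dots> = finsum P (\<lambda>s. a \<odot>\<^bsub>P\<^esub> g u s) ?A"
        by (rule P.finsum_cong') (use that assms(2) gc in \<open>auto simp: g_def free_module_def Pi_iff P.smult_assoc1\<close>)
      also have "\<dots> = a \<odot>\<^bsub>P\<^esub> L u" unfolding L_def
        by (rule P.finsum_smult_ldistr[symmetric]) (use that gc fin in auto)
      finally show ?thesis .
    qed
    show "L (free_gen R s) = f s" if "s \<in> S" for s
    proof -
      have "L (free_gen R s) = finsum P (g (free_gen R s)) {s}"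
        by (rule Leq) (use free_gen_closed[OF P.R.is_cring that] in \<open>auto simp: free_gen_def\<close>)
      also have "\<dots> = f s" using that assms(2) by (auto simp: g_def free_gen_def Pi_iff)
      finally show ?thesis .
    qed
  qed
qed

lemma free_generated: fixes R (structure)
  assumes "cring R" "submodule H R (free_module R S)" "\<And>s. s \<in> S \<Longrightarrow> free_gen R s \<in> H"
  shows "carrier (free_module R S) \<subseteq> H"
proof
  interpret cring R by fact
  let ?F = "free_module R S"
  interpret F: module R ?F by (rule module_free) fact
  interpret H: submodule H R ?F by fact
  fix u assume "u \<in> carrier ?F"
  then have "finite {s. u s \<noteq> \<zero>}" by (auto simp: free_module_def)
  from this \<open>u \<in> carrier ?F\<close> show "u \<in> H"
  proof (induction "{s. u s \<noteq> \<zero>}" arbitrary: u rule: finite_induct)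
    case empty
    then have "u = \<zero>\<^bsub>?F\<^esub>" by (auto simp: free_module_def)
    then show ?case using H.one_closed by simp
  next
    case (insert s A)
    have s: "s \<in> S" "u s \<in> carrier R" using insert by (auto simp: free_module_def)
    let ?v = "u(s := \<zero>)"
    have A: "A = {t. ?v t \<noteq> \<zero>}" using insert(2,4) by auto
    have v: "?v \<in> carrier ?F" using insert(5) insert(1) A by (auto simp: free_module_def)
    have "?v \<in> H" using insert(3)[OF A v] .
    moreover have "u s \<odot>\<^bsub>?F\<^esub> free_gen R s \<in> H" using assms(3) s by (intro H.smult_closed)
    moreover have "u = ?v \<oplus>\<^bsub>?F\<^esub> u s \<odot>\<^bsub>?F\<^esub> free_gen R s"
      using insert(5) by (auto simp: free_module_def free_gen_def fun_eq_iff)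
    ultimately show ?case using H.m_closed by fastforce
  qed
qed

theorem tensor_universal:
  assumes M: "module R M" and N: "module R N"
  shows "module R (tensor_product R M N)" 
    and "bilinear_map R M N (tensor_product R M N) (tensor_elt R M N)"
    and "module R P \<Longrightarrow> bilinear_map R M N P f \<Longrightarrow> \<exists>!h. h \<in> lin_hom R (tensor_product R M N) P \<and>
       (\<forall>x\<in>carrier M. \<forall>y\<in>carrier N. h (tensor_elt R M N x y) = f x y)"
proof -
  interpret M: module R M by fact
  interpret N: module R N by fact
  let ?S = "carrier M \<times> carrier N" let ?F = "free_module R ?S" let ?K = "tensor_kernel R M N"
  interpret F: module R ?F by (rule module_free) (rule M.R.is_cring)
  note gc = free_gen_closed[OF M.R.is_cring, of _ ?S]
  have rel: "tensor_relations R M N \<subseteq> carrier ?F"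
    unfolding tensor_relations_def Let_def by (auto intro!: F.minus_closed F.a_closed F.smult_closed gc)
  have K: "submodule ?K R ?F" and RK: "tensor_relations R M N \<subseteq> ?K"
    unfolding tensor_kernel_def using submodule_span[OF F.module_axioms rel] by auto
  interpret K: submodule ?K R ?F by fact
  interpret KS: additive_subgroup ?K ?F by unfold_locales
  interpret KA: abelian_subgroup ?K ?F
    by (rule abelian_subgroupI3) (unfold_locales)
  note Q = module_quotient[OF F.module_axioms K, folded tensor_product_def]
  show MT: "module R (tensor_product R M N)" by (rule Q)
  interpret T: module R "tensor_product R M N" by fact
  have eqK: "?K +>\<^bsub>?F\<^esub> u = ?K +>\<^bsub>?F\<^esub> v" if "u \<in> carrier ?F" "v \<in> carrier ?F" "u \<ominus>\<^bsub>?F\<^esub> v \<in> ?K" for u v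
  proof -
    have "(u \<ominus>\<^bsub>?F\<^esub> v) \<oplus>\<^bsub>?F\<^esub> v = u" using that(1,2)
      by (simp add: a_minus_def F.a_assoc F.l_neg)
    then have "u \<in> ?K +>\<^bsub>?F\<^esub> v" using that(3) unfolding a_r_coset_def' by force
    then show ?thesis
      using F.a_repr_independence'[of u ?K v, folded a_r_coset_def] that K.subgroup_axioms by metis
  qed
  show bil: "bilinear_map R M N (tensor_product R M N) (tensor_elt R M N)"
    unfolding bilinear_map_def
  proof (intro conjI ballI)
    fix x x' y assume [simp]: "x \<in> carrier M" "x' \<in> carrier M" "y \<in> carrier N"
    have "free_gen R (x \<oplus>\<^bsub>M\<^esub> x', y) \<ominus>\<^bsub>?F\<^esub> (free_gen R (x, y) \<oplus>\<^bsub>?F\<^esub> free_gen R (x', y)) \<in> ?K"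
      by (rule subsetD[OF RK], unfold tensor_relations_def Let_def) (use \<open>x \<in> carrier M\<close> \<open>x' \<in> carrier M\<close> \<open>y \<in> carrier N\<close> in blast)
    then show "tensor_elt R M N (x \<oplus>\<^bsub>M\<^esub> x') y = tensor_elt R M N x y \<oplus>\<^bsub>tensor_product R M N\<^esub> tensor_elt R M N x' y"
      unfolding tensor_elt_def by (simp add: Q gc) (rule eqK, auto simp: gc)
  next
    fix x y' y assume [simp]: "x \<in> carrier M" "y \<in> carrier N" "y' \<in> carrier N" 
    have "free_gen R (x, y \<oplus>\<^bsub>N\<^esub> y') \<ominus>\<^bsub>?F\<^esub> (free_gen R (x, y) \<oplus>\<^bsub>?F\<^esub> free_gen R (x, y')) \<in> ?K"
      by (rule subsetD[OF RK], unfold tensor_relations_def Let_def) (use \<open>x \<in> carrier M\<close> \<open>y' \<in> carrier N\<close> \<open>y \<in> carrier N\<close> in blast)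
    then show "tensor_elt R M N x (y \<oplus>\<^bsub>N\<^esub> y') = tensor_elt R M N x y \<oplus>\<^bsub>tensor_product R M N\<^esub> tensor_elt R M N x y'"
      unfolding tensor_elt_def by (simp add: Q gc) (rule eqK, auto simp: gc)
  next
    fix a x y assume [simp]: "a \<in> carrier R" "x \<in> carrier M" "y \<in> carrier N" 
    have "free_gen R (a \<odot>\<^bsub>M\<^esub> x, y) \<ominus>\<^bsub>?F\<^esub> (a \<odot>\<^bsub>?F\<^esub> free_gen R (x, y)) \<in> ?K"
      by (rule subsetD[OF RK], unfold tensor_relations_def Let_def) (use \<open>x \<in> carrier M\<close> \<open>a \<in> carrier R\<close> \<open>y \<in> carrier N\<close> in blast)
    then show "tensor_elt R M N (a \<odot>\<^bsub>M\<^esub> x) y = a \<odot>\<^bsub>tensor_product R M N\<^esub> tensor_elt R M N x y"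
      unfolding tensor_elt_def by (simp add: Q gc) (rule eqK, auto simp: gc)
    have "free_gen R (x, a \<odot>\<^bsub>N\<^esub> y) \<ominus>\<^bsub>?F\<^esub> (a \<odot>\<^bsub>?F\<^esub> free_gen R (x, y)) \<in> ?K"
      by (rule subsetD[OF RK], unfold tensor_relations_def Let_def) (use \<open>x \<in> carrier M\<close> \<open>a \<in> carrier R\<close> \<open>y \<in> carrier N\<close> in blast)
    then show "tensor_elt R M N x (a \<odot>\<^bsub>N\<^esub> y) = a \<odot>\<^bsub>tensor_product R M N\<^esub> tensor_elt R M N x y"
      unfolding tensor_elt_def by (simp add: Q gc) (rule eqK, auto simp: gc)
  qed (auto simp: tensor_elt_def Q gc)
  have cE: "\<exists>u\<in>carrier ?F. C = ?K +>\<^bsub>?F\<^esub> u" if "C \<in> carrier (tensor_product R M N)" for C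
    using that unfolding tensor_product_def quotient_module_def A_RCOSETS_def' by auto
  assume P: "module R P" and f: "bilinear_map R M N P f"
  interpret P: module R P by fact
  have f': "case_prod f \<in> ?S \<rightarrow> carrier P" using f unfolding bilinear_map_def by auto
  obtain L where L: "\<And>u. u \<in> carrier ?F \<Longrightarrow> L u \<in> carrier P"
    "\<And>u v. u \<in> carrier ?F \<Longrightarrow> v \<in> carrier ?F \<Longrightarrow> L (u \<oplus>\<^bsub>?F\<^esub> v) = L u \<oplus>\<^bsub>P\<^esub> L v"
    "\<And>a u. a \<in> carrier R \<Longrightarrow> u \<in> carrier ?F \<Longrightarrow> L (a \<odot>\<^bsub>?F\<^esub> u) = a \<odot>\<^bsub>P\<^esub> L u"
    "\<And>s. s \<in> ?S \<Longrightarrow> L (free_gen R s) = case_prod f s"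
    by (rule free_lift[OF P f']) (rule that)
  have L0: "L \<zero>\<^bsub>?F\<^esub> = \<zero>\<^bsub>P\<^esub>" using L(3)[of "\<zero>\<^bsub>R\<^esub>" "\<zero>\<^bsub>?F\<^esub>"] L(1)[of "\<zero>\<^bsub>?F\<^esub>"] by simp
  have Ln: "L (\<ominus>\<^bsub>?F\<^esub> u) = \<ominus>\<^bsub>P\<^esub> L u" if "u \<in> carrier ?F" for u
    using L(2)[of "\<ominus>\<^bsub>?F\<^esub> u" u] that L0 L(1) by (simp add: F.l_neg P.minus_equality)
  have ker: "submodule {u \<in> carrier ?F. L u = \<zero>\<^bsub>P\<^esub>} R ?F"
    by (rule F.submoduleI) (auto simp: L L0 Ln)
  have Lm: "L (u \<ominus>\<^bsub>?F\<^esub> v) = \<zero>\<^bsub>P\<^esub>" if "u \<in> carrier ?F" "v \<in> carrier ?F" "L u = L v" for u v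
    using that by (simp add: a_minus_def L Ln P.r_neg)
  have "tensor_relations R M N \<subseteq> {u \<in> carrier ?F. L u = \<zero>\<^bsub>P\<^esub>}"
    using rel unfolding tensor_relations_def Let_def
    by (auto intro!: Lm gc) (use f in \<open>auto simp: L gc bilinear_map_def\<close>)
  then have Kker: "?K \<subseteq> {u \<in> carrier ?F. L u = \<zero>\<^bsub>P\<^esub>}"
    unfolding tensor_kernel_def submodule_span_def using ker by blast
  define h where "h = (\<lambda>C\<in>carrier (tensor_product R M N). L (SOME u. u \<in> C))"
  have hK: "h (?K +>\<^bsub>?F\<^esub> u) = L u" if u: "u \<in> carrier ?F" for u
  proof -
    have "u \<in> ?K +>\<^bsub>?F\<^esub> u" using u KA.a_rcos_self by simp
    then have "(SOME v. v \<in> ?K +>\<^bsub>?F\<^esub> u) \<in> ?K +>\<^bsub>?F\<^esub> u" using someI_ex[of "\<lambda>v. v \<in> ?K +>\<^bsub>?F\<^esub> u"] by blast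
    then obtain k where "k \<in> ?K" "(SOME v. v \<in> ?K +>\<^bsub>?F\<^esub> u) = k \<oplus>\<^bsub>?F\<^esub> u" unfolding a_r_coset_def' by blast
    moreover have "k \<in> carrier ?F" "L k = \<zero>\<^bsub>P\<^esub>" using Kker \<open>k \<in> ?K\<close> by auto
    ultimately show ?thesis using u Q(2) by (simp add: h_def L)
  qed
  show "\<exists>!h. h \<in> lin_hom R (tensor_product R M N) P \<and>
       (\<forall>x\<in>carrier M. \<forall>y\<in>carrier N. h (tensor_elt R M N x y) = f x y)"
  proof (rule ex1I[of _ h], intro conjI ballI)
    show "h \<in> lin_hom R (tensor_product R M N) P"
    proof (rule lin_homI)
      show "h \<in> carrier (tensor_product R M N) \<rightarrow>\<^sub>E carrier P"
      proof
        show "h C \<in> carrier P" if "C \<in> carrier (tensor_product R M N)" for C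
          using cE[OF that] hK L(1) by auto
      qed (simp add: h_def)
    qed (auto dest!: cE simp: Q hK L)
    show "h (tensor_elt R M N x y) = f x y" if "x \<in> carrier M" "y \<in> carrier N" for x y
      unfolding tensor_elt_def using that by (simp add: hK gc L)
  next
    fix g assume g: "g \<in> lin_hom R (tensor_product R M N) P \<and> (\<forall>x\<in>carrier M. \<forall>y\<in>carrier N. g (tensor_elt R M N x y) = f x y)"
    define G where "G u = g (?K +>\<^bsub>?F\<^esub> u)" for u
    have gT: "g (C \<oplus>\<^bsub>tensor_product R M N\<^esub> D) = g C \<oplus>\<^bsub>P\<^esub> g D" "g C \<in> carrier P" "a \<in> carrier R \<Longrightarrow> g (a \<odot>\<^bsub>tensor_product R M N\<^esub> C) = a \<odot>\<^bsub>P\<^esub> g C"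
      if "C \<in> carrier (tensor_product R M N)" "D \<in> carrier (tensor_product R M N)" for C D a
      using g that unfolding lin_hom_def by (auto simp: PiE_iff)
    have Gc: "G u \<in> carrier P" if "u \<in> carrier ?F" for u unfolding G_def using gT Q(2) that by blast
    have Ga: "G (u \<oplus>\<^bsub>?F\<^esub> v) = G u \<oplus>\<^bsub>P\<^esub> G v" if "u \<in> carrier ?F" "v \<in> carrier ?F" for u v
      unfolding G_def using gT Q(2,3) that by metis
    have Gs: "G (a \<odot>\<^bsub>?F\<^esub> u) = a \<odot>\<^bsub>P\<^esub> G u" if "u \<in> carrier ?F" "a \<in> carrier R" for u a
      unfolding G_def using gT Q(2,4) that by metis
    have G0: "G \<zero>\<^bsub>?F\<^esub> = \<zero>\<^bsub>P\<^esub>" using Gs[of "\<zero>\<^bsub>?F\<^esub>" "\<zero>\<^bsub>R\<^esub>"] Gc[of "\<zero>\<^bsub>?F\<^esub>"] by simp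
    have Gn: "G (\<ominus>\<^bsub>?F\<^esub> u) = \<ominus>\<^bsub>P\<^esub> G u" if "u \<in> carrier ?F" for u
      using Ga[of "\<ominus>\<^bsub>?F\<^esub> u" u] that G0 Gc by (simp add: F.l_neg P.minus_equality)
    have "carrier ?F \<subseteq> {u \<in> carrier ?F. G u = L u}"
    proof (rule free_generated[OF M.R.is_cring])
      show "submodule {u \<in> carrier ?F. G u = L u} R ?F"
        by (rule F.submoduleI) (auto simp: L L0 Ln Ga Gs G0 Gn)
      show "free_gen R s \<in> {u \<in> carrier ?F. G u = L u}" if "s \<in> ?S" for s
        using that g gc[OF that] L(4)[OF that] by (auto simp: G_def tensor_elt_def)
    qed
    then have GL: "G u = L u" if "u \<in> carrier ?F" for u using that by auto
    show "g = h"
    proof (rule extensionalityI)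
      show "g \<in> extensional (carrier (tensor_product R M N))" using g by (auto simp: lin_hom_def PiE_def)
      show "h \<in> extensional (carrier (tensor_product R M N))" by (simp add: h_def)
      show "g C = h C" if "C \<in> carrier (tensor_product R M N)" for C
        using cE[OF that] GL hK unfolding G_def by auto
    qed
  qed
qed

text \<open>The map \<open>f \<otimes> g : M \<otimes> N \<rightarrow> M' \<otimes> N'\<close> for \<open>f : M \<rightarrow> M'\<close> and \<open>g : N \<rightarrow> N'\<close>.\<close>

definition tensor_map ::
    "('r, 'x) ring_scheme \<Rightarrow> ('r, 'm, 'y) module_scheme \<Rightarrow> ('r, 'n, 'z) module_scheme
      \<Rightarrow> ('r, 'k, 'v) module_scheme \<Rightarrow> ('r, 'l, 'w) module_scheme
      \<Rightarrow> ('m \<Rightarrow> 'k) \<Rightarrow> ('n \<Rightarrow> 'l) \<Rightarrow> ('m \<times> 'n \<Rightarrow> 'r) set \<Rightarrow> ('k \<times> 'l \<Rightarrow> 'r) set"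
  where "tensor_map R M N M' N' f g =
    the_hom R (tensor_product R M N) (tensor_product R M' N')
      (\<lambda>h. \<forall>x\<in>carrier M. \<forall>y\<in>carrier N. h (tensor_elt R M N x y) = tensor_elt R M' N' (f x) (g y))"


section \<open>Tensor cubes\<close>

text \<open>
  The cube \<open>N\<^sup>\<otimes>\<^sup>3\<close> is \<open>(N \<otimes> N) \<otimes> N\<close>.  The usual identification with \<open>N \<otimes> (N \<otimes> N)\<close>
  is made explicit by the two mutually inverse maps \<open>assoc_to_left\<close> and \<open>assoc_to_right\<close>.
\<close>

definition tensor_square ::
    "('r, 'x) ring_scheme \<Rightarrow> ('r, 'n, 'z) module_scheme \<Rightarrow> ('r, ('n \<times> 'n \<Rightarrow> 'r) set) module"
  where "tensor_square R N = tensor_product R N N"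

definition tensor_cube ::
    "('r, 'x) ring_scheme \<Rightarrow> ('r, 'n, 'z) module_scheme
      \<Rightarrow> ('r, (('n \<times> 'n \<Rightarrow> 'r) set \<times> 'n \<Rightarrow> 'r) set) module"
  where "tensor_cube R N = tensor_product R (tensor_square R N) N"

definition tensor_elt3 ::
    "('r, 'x) ring_scheme \<Rightarrow> ('r, 'n, 'z) module_scheme
      \<Rightarrow> 'n \<Rightarrow> 'n \<Rightarrow> 'n \<Rightarrow> (('n \<times> 'n \<Rightarrow> 'r) set \<times> 'n \<Rightarrow> 'r) set"
  where "tensor_elt3 R N x y z = tensor_elt R (tensor_square R N) N (tensor_elt R N N x y) z"

definition assoc_to_left ::
    "('r, 'x) ring_scheme \<Rightarrow> ('r, 'n, 'z) module_scheme
      \<Rightarrow> ('n \<times> ('n \<times> 'n \<Rightarrow> 'r) set \<Rightarrow> 'r) set \<Rightarrow> (('n \<times> 'n \<Rightarrow> 'r) set \<times> 'n \<Rightarrow> 'r) set"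
  where "assoc_to_left R N =
    the_hom R (tensor_product R N (tensor_square R N)) (tensor_cube R N)
      (\<lambda>h. \<forall>x\<in>carrier N. \<forall>y\<in>carrier N. \<forall>z\<in>carrier N.
         h (tensor_elt R N (tensor_square R N) x (tensor_elt R N N y z)) = tensor_elt3 R N x y z)"

definition assoc_to_right ::
    "('r, 'x) ring_scheme \<Rightarrow> ('r, 'n, 'z) module_scheme
      \<Rightarrow> (('n \<times> 'n \<Rightarrow> 'r) set \<times> 'n \<Rightarrow> 'r) set \<Rightarrow> ('n \<times> ('n \<times> 'n \<Rightarrow> 'r) set \<Rightarrow> 'r) set"
  where "assoc_to_right R N =
    the_hom R (tensor_cube R N) (tensor_product R N (tensor_square R N))
      (\<lambda>h. \<forall>x\<in>carrier N. \<forall>y\<in>carrier N. \<forall>z\<in>carrier N.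
         h (tensor_elt3 R N x y z) = tensor_elt R N (tensor_square R N) x (tensor_elt R N N y z))"


section \<open>The action of the symmetric group on three letters\<close>

definition sub_S3 :: "nat \<Rightarrow> (nat \<Rightarrow> nat) set"
  where "sub_S3 i =
    (if i = 1 then {id}
     else if i = 2 then {id, transpose 1 2}
     else if i = 3 then {id, transpose 2 3}
     else if i = 4 then {id, transpose 1 3}
     else if i = 5 then {id, transpose 1 2 \<circ> transpose 2 3, transpose 2 3 \<circ> transpose 1 2}
     else {\<sigma>. \<sigma> permutes {1, 2, 3}})"

definition Phi ::
    "('r, 'x) ring_scheme \<Rightarrow> ('r, 'n, 'z) module_scheme \<Rightarrow> (nat \<Rightarrow> nat)
      \<Rightarrow> (('n \<times> 'n \<Rightarrow> 'r) set \<times> 'n \<Rightarrow> 'r) set \<Rightarrow> (('n \<times> 'n \<Rightarrow> 'r) set \<times> 'n \<Rightarrow> 'r) set"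
  where "Phi R N \<sigma> =
    the_hom R (tensor_cube R N) (tensor_cube R N)
      (\<lambda>h. \<forall>x. (\<forall>j\<in>{1, 2, 3}. x j \<in> carrier N) \<longrightarrow>
         h (tensor_elt3 R N (x 1) (x 2) (x 3)) =
           tensor_elt3 R N (x (inv_into UNIV \<sigma> 1)) (x (inv_into UNIV \<sigma> 2)) (x (inv_into UNIV \<sigma> 3)))"

definition Phi_sum ::
    "('r, 'x) ring_scheme \<Rightarrow> ('r, 'n, 'z) module_scheme \<Rightarrow> nat
      \<Rightarrow> (('n \<times> 'n \<Rightarrow> 'r) set \<times> 'n \<Rightarrow> 'r) set \<Rightarrow> (('n \<times> 'n \<Rightarrow> 'r) set \<times> 'n \<Rightarrow> 'r) set"
  where "Phi_sum R N i =
    (\<Oplus>\<^bsub>hom_module R (tensor_cube R N) (tensor_cube R N)\<^esub> \<sigma> \<in> sub_S3 i.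
       add_pow (hom_module R (tensor_cube R N) (tensor_cube R N)) (sign \<sigma>) (Phi R N \<sigma>))"


section \<open>Coalgebras and algebras\<close>

definition coassociator ::
    "('r, 'x) ring_scheme \<Rightarrow> ('r, 'm, 'y) module_scheme \<Rightarrow> ('m \<Rightarrow> ('m \<times> 'm \<Rightarrow> 'r) set)
      \<Rightarrow> 'm \<Rightarrow> (('m \<times> 'm \<Rightarrow> 'r) set \<times> 'm \<Rightarrow> 'r) set"
  where "coassociator R M \<Delta> =
    compose (carrier M) (tensor_map R M M (tensor_square R M) M \<Delta> (id_hom M)) \<Delta>
    \<ominus>\<^bsub>hom_module R M (tensor_cube R M)\<^esub>
    compose (carrier M) (assoc_to_left R M)
      (compose (carrier M) (tensor_map R M M M (tensor_square R M) (id_hom M) \<Delta>) \<Delta>)"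

definition G_coalgebra ::
    "('r, 'x) ring_scheme \<Rightarrow> nat \<Rightarrow> ('r, 'm, 'y) module_scheme
      \<Rightarrow> ('m \<Rightarrow> ('m \<times> 'm \<Rightarrow> 'r) set) \<Rightarrow> bool"
  where "G_coalgebra R i M \<Delta> \<longleftrightarrow>
    module R M \<and> \<Delta> \<in> lin_hom R M (tensor_square R M) \<and>
    (\<Oplus>\<^bsub>hom_module R M (tensor_cube R M)\<^esub> \<sigma> \<in> sub_S3 i.
       add_pow (hom_module R M (tensor_cube R M)) (sign \<sigma>)
         (compose (carrier M) (Phi R M \<sigma>) (coassociator R M \<Delta>)))
    = \<zero>\<^bsub>hom_module R M (tensor_cube R M)\<^esub>"

definition associator ::
    "('r, 'x) ring_scheme \<Rightarrow> ('r, 'n, 'z) module_scheme \<Rightarrow> (('n \<times> 'n \<Rightarrow> 'r) set \<Rightarrow> 'n)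
      \<Rightarrow> (('n \<times> 'n \<Rightarrow> 'r) set \<times> 'n \<Rightarrow> 'r) set \<Rightarrow> 'n"
  where "associator R N \<mu> =
    compose (carrier (tensor_cube R N)) \<mu> (tensor_map R (tensor_square R N) N N N \<mu> (id_hom N))
    \<ominus>\<^bsub>hom_module R (tensor_cube R N) N\<^esub>
    compose (carrier (tensor_cube R N)) \<mu>
      (compose (carrier (tensor_cube R N))
        (tensor_map R N (tensor_square R N) N N (id_hom N) \<mu>) (assoc_to_right R N))"

definition G_associative_algebra ::
    "('r, 'x) ring_scheme \<Rightarrow> nat \<Rightarrow> ('r, 'n, 'z) module_scheme
      \<Rightarrow> (('n \<times> 'n \<Rightarrow> 'r) set \<Rightarrow> 'n) \<Rightarrow> bool"
  where "G_associative_algebra R i N \<mu> \<longleftrightarrow>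
    module R N \<and> \<mu> \<in> lin_hom R (tensor_square R N) N \<and>
    compose (carrier (tensor_cube R N)) (associator R N \<mu>) (Phi_sum R N i)
    = \<zero>\<^bsub>hom_module R (tensor_cube R N) N\<^esub>"


section \<open>The multiplication on the dual of a coalgebra\<close>

definition mult_map :: "('r, 'x) ring_scheme \<Rightarrow> ('r \<times> 'r \<Rightarrow> 'r) set \<Rightarrow> 'r"
  where "mult_map R =
    the_hom R (tensor_square R (regular_module R)) (regular_module R)
      (\<lambda>h. \<forall>a\<in>carrier R. \<forall>b\<in>carrier R.
         h (tensor_elt R (regular_module R) (regular_module R) a b) = a \<otimes>\<^bsub>R\<^esub> b)"

definition lambda2 ::
    "('r, 'x) ring_scheme \<Rightarrow> ('r, 'm, 'y) module_scheme
      \<Rightarrow> (('m \<Rightarrow> 'r) \<times> ('m \<Rightarrow> 'r) \<Rightarrow> 'r) set \<Rightarrow> ('m \<times> 'm \<Rightarrow> 'r) set \<Rightarrow> ('r \<times> 'r \<Rightarrow> 'r) set"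
  where "lambda2 R M =
    the_hom R (tensor_square R (dual_module R M))
      (hom_module R (tensor_square R M) (tensor_square R (regular_module R)))
      (\<lambda>h. \<forall>f\<^sub>1\<in>carrier (dual_module R M). \<forall>f\<^sub>2\<in>carrier (dual_module R M).
         \<forall>x\<^sub>1\<in>carrier M. \<forall>x\<^sub>2\<in>carrier M.
         h (tensor_elt R (dual_module R M) (dual_module R M) f\<^sub>1 f\<^sub>2) (tensor_elt R M M x\<^sub>1 x\<^sub>2) =
           tensor_elt R (regular_module R) (regular_module R) (f\<^sub>1 x\<^sub>1) (f\<^sub>2 x\<^sub>2))"

definition convolution ::
    "('r, 'x) ring_scheme \<Rightarrow> ('r, 'm, 'y) module_scheme \<Rightarrow> ('m \<Rightarrow> ('m \<times> 'm \<Rightarrow> 'r) set)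
      \<Rightarrow> ('m \<Rightarrow> 'r) \<Rightarrow> ('m \<Rightarrow> 'r) \<Rightarrow> 'm \<Rightarrow> 'r"
  where "convolution R M \<Delta> f\<^sub>1 f\<^sub>2 =
    compose (carrier M) (mult_map R)
      (compose (carrier M)
        (lambda2 R M (tensor_elt R (dual_module R M) (dual_module R M) f\<^sub>1 f\<^sub>2)) \<Delta>)"

definition dual_mult ::
    "('r, 'x) ring_scheme \<Rightarrow> ('r, 'm, 'y) module_scheme \<Rightarrow> ('m \<Rightarrow> ('m \<times> 'm \<Rightarrow> 'r) set)
      \<Rightarrow> (('m \<Rightarrow> 'r) \<times> ('m \<Rightarrow> 'r) \<Rightarrow> 'r) set \<Rightarrow> 'm \<Rightarrow> 'r"
  where "dual_mult R M \<Delta> =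
    the_hom R (tensor_square R (dual_module R M)) (dual_module R M)
      (\<lambda>\<mu>. \<forall>f\<^sub>1\<in>carrier (dual_module R M). \<forall>f\<^sub>2\<in>carrier (dual_module R M).
         \<mu> (tensor_elt R (dual_module R M) (dual_module R M) f\<^sub>1 f\<^sub>2) = convolution R M \<Delta> f\<^sub>1 f\<^sub>2)"

end

theory Submission
  imports Defs
begin

text \<open>
  For \<open>f\<^sub>1, f\<^sub>2, f\<^sub>3 \<in> M\<^sup>*\<close> let \<open>f\<^sub>1 f\<^sub>2 f\<^sub>3\<close> be the functional \<open>x \<otimes> y \<otimes> z \<mapsto> f\<^sub>1(x) f\<^sub>2(y) f\<^sub>3(z)\<close> on \<open>M\<^sup>\<otimes>\<^sup>3\<close>.
  Comparing values on pure tensors gives \<open>A(\<mu>)(f\<^sub>1 \<otimes> f\<^sub>2 \<otimes> f\<^sub>3) = (f\<^sub>1 f\<^sub>2 f\<^sub>3) \<circ> A\<^sup>~(\<Delta>)\<close>, and permuting the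
  functionals by \<open>\<sigma>\<close> amounts to precomposing with \<open>\<Phi>\<close> at the inverse permutation.  Every \<open>G\<^sub>i\<close> is
  closed under inverses, which preserve signs, so the signed sum over \<open>G\<^sub>i\<close> of the associators is the
  functional \<open>f\<^sub>1 f\<^sub>2 f\<^sub>3\<close> applied to the signed sum that vanishes by hypothesis.
\<close>


section \<open>Linear maps\<close>

lemma the_homI:
  assumes "\<exists>!h. h \<in> lin_hom R M N \<and> P h"
  shows "the_hom R M N P \<in> lin_hom R M N" and "P (the_hom R M N P)"
  using theI'[OF assms] unfolding the_hom_def by auto

lemma lin_hom_closed: "f \<in> lin_hom R M N \<Longrightarrow> x \<in> carrier M \<Longrightarrow> f x \<in> carrier N"
  unfolding lin_hom_def by auto

lemma lin_hom_add:
  "f \<in> lin_hom R M N \<Longrightarrow> x \<in> carrier M \<Longrightarrow> y \<in> carrier M \<Longrightarrow> f (x \<oplus>\<^bsub>M\<^esub> y) = f x \<oplus>\<^bsub>N\<^esub> f y"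
  unfolding lin_hom_def by auto

lemma lin_hom_smult:
  "f \<in> lin_hom R M N \<Longrightarrow> a \<in> carrier R \<Longrightarrow> x \<in> carrier M \<Longrightarrow> f (a \<odot>\<^bsub>M\<^esub> x) = a \<odot>\<^bsub>N\<^esub> f x"
  unfolding lin_hom_def by auto

lemma lin_hom_extensional: "f \<in> lin_hom R M N \<Longrightarrow> f \<in> extensional (carrier M)"
  unfolding lin_hom_def by (auto simp: PiE_iff)

lemma lin_hom_eqI:
  assumes "f \<in> lin_hom R M N" "g \<in> lin_hom R M P" "\<And>x. x \<in> carrier M \<Longrightarrow> f x = g x"
  shows "f = g"
  using assms by (meson extensionalityI lin_hom_extensional)

lemma lin_hom_compose:
  assumes "module R M" "f \<in> lin_hom R M N" "g \<in> lin_hom R N P"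
  shows "compose (carrier M) g f \<in> lin_hom R M P"
proof -
  interpret M: module R M by fact
  show ?thesis
    by (rule lin_homI)
      (auto simp: compose_def lin_hom_closed[OF assms(2)] lin_hom_closed[OF assms(3)]
        lin_hom_add[OF assms(2)] lin_hom_add[OF assms(3)] lin_hom_smult[OF assms(2)] lin_hom_smult[OF assms(3)])
qed

lemma id_hom_lin: "module R M \<Longrightarrow> id_hom M \<in> lin_hom R M M"
proof -
  assume "module R M"
  then interpret M: module R M .
  show ?thesis by (rule lin_homI) (auto simp: id_hom_def)
qed

section \<open>Pointwise operations and composition in Hom modules\<close>

lemma carrier_hom_module [simp]: "carrier (hom_module R M N) = lin_hom R M N"
  by (simp add: hom_module_def)

lemma hom_module_add:
  "x \<in> carrier M \<Longrightarrow> (f \<oplus>\<^bsub>hom_module R M N\<^esub> g) x = f x \<oplus>\<^bsub>N\<^esub> g x"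
  by (simp add: hom_module_def)

lemma hom_module_smult:
  "x \<in> carrier M \<Longrightarrow> (a \<odot>\<^bsub>hom_module R M N\<^esub> f) x = a \<odot>\<^bsub>N\<^esub> f x"
  by (simp add: hom_module_def)

lemma hom_module_zero:
  "x \<in> carrier M \<Longrightarrow> \<zero>\<^bsub>hom_module R M N\<^esub> x = \<zero>\<^bsub>N\<^esub>"
  by (simp add: hom_module_def)

text \<open>Signs enter as integer multiples, so additivity of \<open>h\<close> alone moves it
  through a signed sum. It serves both signed sums of the main argument: evaluation maps carry them
  from Hom modules down to the ring.\<close>

lemma additive_signed_sum:
  fixes s :: "'s \<Rightarrow> int"
  assumes A: "abelian_group A" and B: "abelian_group B"
    and h: "h \<in> carrier A \<rightarrow> carrier B"
      "\<And>x y. x \<in> carrier A \<Longrightarrow> y \<in> carrier A \<Longrightarrow> h (x \<oplus>\<^bsub>A\<^esub> y) = h x \<oplus>\<^bsub>B\<^esub> h y"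
    and F: "F \<in> S \<rightarrow> carrier A" and S: "finite S"
  shows "h (\<Oplus>\<^bsub>A\<^esub>\<sigma>\<in>S. add_pow A (s \<sigma>) (F \<sigma>)) = (\<Oplus>\<^bsub>B\<^esub>\<sigma>\<in>S. add_pow B (s \<sigma>) (h (F \<sigma>)))"
proof -
  interpret A: abelian_group A by fact
  interpret B: abelian_group B by fact
  \<comment> \<open>Passing to the additive monoids makes \<open>h\<close> a group homomorphism, so
    compatibility with negative multiples comes with that of integer powers.\<close>
  have hom: "h \<in> hom (add_monoid A) (add_monoid B)" using h by (auto simp: hom_def)
  interpret h: group_hom "add_monoid A" "add_monoid B" h
    by unfold_locales (rule hom)
  have pow: "h (add_pow A k x) = add_pow B k (h x)" if "x \<in> carrier A" for k :: int and x
    using h.hom_int_pow[of x k] that by (simp add: add_pow_def)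
  have zero: "h \<zero>\<^bsub>A\<^esub> = \<zero>\<^bsub>B\<^esub>" using h.hom_one by simp
  show ?thesis
    using S F
  proof (induction S)
    case empty
    then show ?case by (simp add: zero)
  next
    case (insert \<sigma> S)
    then show ?case using h(1)
      by (simp add: A.finsum_insert B.finsum_insert A.finsum_closed h(2) pow Pi_iff A.add.int_pow_closed)
  qed
qed

lemma lin_hom_hom_zero:
  assumes "module R M" "module R N"
  shows "\<zero>\<^bsub>hom_module R M N\<^esub> \<in> lin_hom R M N"
proof -
  interpret H: module R "hom_module R M N" by (rule module_hom_module) fact+
  show ?thesis using H.zero_closed by simp
qed

lemma lin_hom_hom_minus:
  assumes "module R M" "module R N" "f \<in> lin_hom R M N" "g \<in> lin_hom R M N"
  shows "f \<ominus>\<^bsub>hom_module R M N\<^esub> g \<in> lin_hom R M N"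
proof -
  interpret H: module R "hom_module R M N" by (rule module_hom_module) fact+
  show ?thesis using H.minus_closed assms(3,4) by simp
qed

text \<open>Negation in \<open>hom_module\<close> is the abstract inverse of its additive group
  rather than a pointwise formula. The value is recovered by evaluating
  \<open>f = (f - g) + g\<close> at \<open>x\<close> and cancelling in \<open>N\<close>.\<close>

lemma hom_module_minus:
  assumes "module R M" "module R N" "f \<in> lin_hom R M N" "g \<in> lin_hom R M N" "x \<in> carrier M"
  shows "(f \<ominus>\<^bsub>hom_module R M N\<^esub> g) x = f x \<ominus>\<^bsub>N\<^esub> g x"
proof -
  interpret N: module R N by fact
  interpret H: module R "hom_module R M N" by (rule module_hom_module) fact+
  let ?d = "f \<ominus>\<^bsub>hom_module R M N\<^esub> g"
  have d: "?d \<in> lin_hom R M N" using lin_hom_hom_minus assms(1-4) .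
  have "f = ?d \<oplus>\<^bsub>hom_module R M N\<^esub> g"
    using assms(3,4) unfolding carrier_hom_module[symmetric]
    by (simp add: a_minus_def H.a_assoc H.l_neg del: carrier_hom_module)
  then have "f x = ?d x \<oplus>\<^bsub>N\<^esub> g x" by (metis hom_module_add assms(5))
  then show ?thesis
    using lin_hom_closed[OF d assms(5)] lin_hom_closed[OF assms(4,5)]
    by (simp add: a_minus_def N.a_assoc N.r_neg)
qed

text \<open>Composition with a fixed map becomes itself an element of a Hom module, hence the
  restriction to \<open>lin_hom R M N\<close>: linear maps are extensional. Bilinear families of
  maps can then be composed with it.\<close>

lemma postcompose_lin:
  assumes "module R M" "module R N" "g \<in> lin_hom R N P"
  shows "(\<lambda>f\<in>lin_hom R M N. compose (carrier M) g f) \<in> lin_hom R (hom_module R M N) (hom_module R M P)"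
proof -
  interpret H: module R "hom_module R M N" by (rule module_hom_module) fact+
  show ?thesis
  proof (rule lin_homI)
    show "(\<lambda>f\<in>lin_hom R M N. compose (carrier M) g f) \<in> carrier (hom_module R M N) \<rightarrow>\<^sub>E carrier (hom_module R M P)"
      using lin_hom_compose[OF assms(1) _ assms(3)] by auto
  next
    fix f f' assume "f \<in> carrier (hom_module R M N)" "f' \<in> carrier (hom_module R M N)"
    with H.a_closed[of f f']
    show "(\<lambda>f\<in>lin_hom R M N. compose (carrier M) g f) (f \<oplus>\<^bsub>hom_module R M N\<^esub> f') =
      (\<lambda>f\<in>lin_hom R M N. compose (carrier M) g f) f \<oplus>\<^bsub>hom_module R M P\<^esub> (\<lambda>f\<in>lin_hom R M N. compose (carrier M) g f) f'"
      by (auto simp: compose_def hom_module_def lin_hom_closed lin_hom_add[OF assms(3)] intro!: restrict_ext)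
  next
    fix a f assume "a \<in> carrier R" "f \<in> carrier (hom_module R M N)"
    with H.smult_closed[of a f]
    show "(\<lambda>f\<in>lin_hom R M N. compose (carrier M) g f) (a \<odot>\<^bsub>hom_module R M N\<^esub> f) =
      a \<odot>\<^bsub>hom_module R M P\<^esub> (\<lambda>f\<in>lin_hom R M N. compose (carrier M) g f) f"
      by (auto simp: compose_def hom_module_def lin_hom_closed lin_hom_smult[OF assms(3)] intro!: restrict_ext)
  qed
qed

lemma precompose_lin:
  assumes "module R L" "module R M" "module R N" "g \<in> lin_hom R L M"
  shows "(\<lambda>f\<in>lin_hom R M N. compose (carrier L) f g) \<in> lin_hom R (hom_module R M N) (hom_module R L N)"
proof -
  interpret H: module R "hom_module R M N" by (rule module_hom_module) fact+
  show ?thesis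
  proof (rule lin_homI)
    show "(\<lambda>f\<in>lin_hom R M N. compose (carrier L) f g) \<in> carrier (hom_module R M N) \<rightarrow>\<^sub>E carrier (hom_module R L N)"
      using lin_hom_compose[OF assms(1,4)] by auto
  next
    fix f f' assume "f \<in> carrier (hom_module R M N)" "f' \<in> carrier (hom_module R M N)"
    with H.a_closed[of f f']
    show "(\<lambda>f\<in>lin_hom R M N. compose (carrier L) f g) (f \<oplus>\<^bsub>hom_module R M N\<^esub> f') =
      (\<lambda>f\<in>lin_hom R M N. compose (carrier L) f g) f \<oplus>\<^bsub>hom_module R L N\<^esub> (\<lambda>f\<in>lin_hom R M N. compose (carrier L) f g) f'"
      by (auto simp: compose_def hom_module_def lin_hom_closed[OF assms(4)] intro!: restrict_ext)
  next
    fix a f assume "a \<in> carrier R" "f \<in> carrier (hom_module R M N)"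
    with H.smult_closed[of a f]
    show "(\<lambda>f\<in>lin_hom R M N. compose (carrier L) f g) (a \<odot>\<^bsub>hom_module R M N\<^esub> f) =
      a \<odot>\<^bsub>hom_module R L N\<^esub> (\<lambda>f\<in>lin_hom R M N. compose (carrier L) f g) f"
      by (auto simp: compose_def hom_module_def lin_hom_closed[OF assms(4)] intro!: restrict_ext)
  qed
qed

lemma id_hom_apply: "x \<in> carrier M \<Longrightarrow> id_hom M x = x"
  by (simp add: id_hom_def)

lemma lin_hom_minus:
  assumes "module R M" "module R N" "h \<in> lin_hom R M N" "x \<in> carrier M" "y \<in> carrier M"
  shows "h (x \<ominus>\<^bsub>M\<^esub> y) = h x \<ominus>\<^bsub>N\<^esub> h y"
proof -
  interpret M: module R M by fact
  interpret N: module R N by fact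
  have "h x = h (x \<ominus>\<^bsub>M\<^esub> y) \<oplus>\<^bsub>N\<^esub> h y"
    using lin_hom_add[OF assms(3), of "x \<ominus>\<^bsub>M\<^esub> y" y] assms(4,5)
    by (simp add: a_minus_def M.a_assoc M.l_neg)
  then show ?thesis
    using lin_hom_closed[OF assms(3)] assms(4,5) by (simp add: a_minus_def N.a_assoc N.r_neg)
qed

lemma lin_hom_zero:
  assumes "module R M" "module R N" "h \<in> lin_hom R M N"
  shows "h \<zero>\<^bsub>M\<^esub> = \<zero>\<^bsub>N\<^esub>"
proof -
  interpret M: module R M by fact
  interpret N: module R N by fact
  show ?thesis
    using lin_hom_smult[OF assms(3) M.R.zero_closed M.zero_closed] lin_hom_closed[OF assms(3) M.zero_closed]
    by simp
qed


section \<open>Maps out of tensor products\<close>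

lemma tensor_elt_closed:
  "module R M \<Longrightarrow> module R N \<Longrightarrow> x \<in> carrier M \<Longrightarrow> y \<in> carrier N \<Longrightarrow>
    tensor_elt R M N x y \<in> carrier (tensor_product R M N)"
  using tensor_universal(2)[of R M N] unfolding bilinear_map_def by blast

lemma bilinear_map_compose:
  assumes "bilinear_map R M N P f" "h \<in> lin_hom R P Q"
  shows "bilinear_map R M N Q (\<lambda>x y. h (f x y))"
  using assms unfolding bilinear_map_def lin_hom_def by (auto simp: PiE_iff)

text \<open>Carriers are closed under the module operations, so bilinearity only sees values there.
  This removes the restriction introduced by \<open>postcompose_lin\<close> and
  \<open>precompose_lin\<close>.\<close>

lemma bilinear_map_cong:
  assumes "module R M" "module R N" "bilinear_map R M N P f"
    and "\<And>x y. x \<in> carrier M \<Longrightarrow> y \<in> carrier N \<Longrightarrow> f x y = g x y"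
  shows "bilinear_map R M N P g"
proof -
  interpret M: module R M by fact
  interpret N: module R N by fact
  show ?thesis
    using assms(3) unfolding bilinear_map_def by (simp add: assms(4))
qed

lemma bilinear_postcompose:
  assumes "module R A" "module R B" "module R M" "module R N" "g \<in> lin_hom R N P"
    and "bilinear_map R A B (hom_module R M N) \<phi>"
  shows "bilinear_map R A B (hom_module R M P) (\<lambda>x y. compose (carrier M) g (\<phi> x y))"
  by (rule bilinear_map_cong[OF assms(1,2) bilinear_map_compose[OF assms(6) postcompose_lin[OF assms(3-5)]]])
    (use assms(6) in \<open>auto simp: bilinear_map_def\<close>)

lemma bilinear_precompose:
  assumes "module R A" "module R B" "module R L" "module R M" "module R N" "g \<in> lin_hom R L M"
    and "bilinear_map R A B (hom_module R M N) \<phi>"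
  shows "bilinear_map R A B (hom_module R L N) (\<lambda>x y. compose (carrier L) (\<phi> x y) g)"
  by (rule bilinear_map_cong[OF assms(1,2) bilinear_map_compose[OF assms(7) precompose_lin[OF assms(3-6)]]])
    (use assms(7) in \<open>auto simp: bilinear_map_def\<close>)

text \<open>The uniqueness half of the universal property, applied to the bilinear map that
  \<open>h\<close> induces. Nearly every identity of maps below is reduced to pure tensors this
  way.\<close>

lemma tensor_hom_eqI:
  assumes "module R M" "module R N" "module R P"
    and g: "g \<in> lin_hom R (tensor_product R M N) P" and h: "h \<in> lin_hom R (tensor_product R M N) P"
    and "\<And>x y. x \<in> carrier M \<Longrightarrow> y \<in> carrier N \<Longrightarrow> g (tensor_elt R M N x y) = h (tensor_elt R M N x y)"
  shows "g = h"
  using tensor_universal(3)[OF assms(1-3) bilinear_map_compose[OF tensor_universal(2) h]] assms by blast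

lemma the_tensor_hom:
  assumes "module R M" "module R N" "module R P" "bilinear_map R M N P f"
  defines "h \<equiv> the_hom R (tensor_product R M N) P
    (\<lambda>h. \<forall>x\<in>carrier M. \<forall>y\<in>carrier N. h (tensor_elt R M N x y) = f x y)"
  shows "h \<in> lin_hom R (tensor_product R M N) P"
    and "\<And>x y. x \<in> carrier M \<Longrightarrow> y \<in> carrier N \<Longrightarrow> h (tensor_elt R M N x y) = f x y"
  using the_homI[OF tensor_universal(3)[OF assms(1-4)]] unfolding h_def by auto

lemma tensor_map:
  assumes "module R M" "module R N" "module R M'" "module R N'"
    and f: "f \<in> lin_hom R M M'" and g: "g \<in> lin_hom R N N'"
  shows "tensor_map R M N M' N' f g \<in> lin_hom R (tensor_product R M N) (tensor_product R M' N')"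
    and "\<And>x y. x \<in> carrier M \<Longrightarrow> y \<in> carrier N \<Longrightarrow>
      tensor_map R M N M' N' f g (tensor_elt R M N x y) = tensor_elt R M' N' (f x) (g y)"
proof -
  have "bilinear_map R M N (tensor_product R M' N') (\<lambda>x y. tensor_elt R M' N' (f x) (g y))"
    using tensor_universal(2)[OF assms(3,4)] f g unfolding bilinear_map_def lin_hom_def
    by (auto simp: PiE_iff)
  note * = the_tensor_hom[OF assms(1,2) tensor_universal(1)[OF assms(3,4)] this, folded tensor_map_def]
  show "tensor_map R M N M' N' f g \<in> lin_hom R (tensor_product R M N) (tensor_product R M' N')"
    by (rule *)
  show "\<And>x y. x \<in> carrier M \<Longrightarrow> y \<in> carrier N \<Longrightarrow>
      tensor_map R M N M' N' f g (tensor_elt R M N x y) = tensor_elt R M' N' (f x) (g y)"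
    by (rule *)
qed

text \<open>Each law is an equation between linear maps on the tensor product of \<open>M\<close>
  and \<open>N\<close>, so it suffices to compare pure tensors, where it is bilinearity of
  \<open>tensor_elt\<close>. This is what makes \<open>lambda2\<close> exist.\<close>

lemma tensor_map_bilinear:
  assumes M: "module R M" and N: "module R N" and M': "module R M'" and N': "module R N'"
  shows "bilinear_map R (hom_module R M M') (hom_module R N N')
    (hom_module R (tensor_product R M N) (tensor_product R M' N')) (tensor_map R M N M' N')"
proof -
  interpret M: module R "hom_module R M M'" by (rule module_hom_module) fact+
  interpret N: module R "hom_module R N N'" by (rule module_hom_module) fact+
  interpret T: module R "hom_module R (tensor_product R M N) (tensor_product R M' N')"
    by (intro module_hom_module tensor_universal(1)) fact+
  note mod = M N tensor_universal(1)[OF M' N']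
  note cl = M.a_closed[simplified] M.smult_closed[simplified] N.a_closed[simplified] N.smult_closed[simplified]
    T.a_closed[simplified] T.smult_closed[simplified] tensor_map(1)[OF M N M' N']
  note val = tensor_map(2)[OF M N M' N'] hom_module_add hom_module_smult tensor_elt_closed M N lin_hom_closed
  note bil = tensor_universal(2)[OF M' N', unfolded bilinear_map_def]
  show ?thesis
    unfolding bilinear_map_def
    by (intro conjI ballI; (rule tensor_hom_eqI[OF mod])?; use bil in \<open>simp add: cl val\<close>)
qed

section \<open>Trilinear maps and triple tensor products\<close>

definition trilinear_map ::
    "('r, 'x) ring_scheme \<Rightarrow> ('r, 'm, 'y) module_scheme \<Rightarrow> ('r, 'n, 'z) module_scheme
      \<Rightarrow> ('r, 'p, 'w) module_scheme \<Rightarrow> ('r, 'q, 'v) module_scheme \<Rightarrow> ('m \<Rightarrow> 'n \<Rightarrow> 'p \<Rightarrow> 'q) \<Rightarrow> bool"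
  where "trilinear_map R M N P Q f \<longleftrightarrow>
    (\<forall>x\<in>carrier M. bilinear_map R N P Q (\<lambda>y z. f x y z)) \<and>
    (\<forall>y\<in>carrier N. bilinear_map R M P Q (\<lambda>x z. f x y z)) \<and>
    (\<forall>z\<in>carrier P. bilinear_map R M N Q (\<lambda>x y. f x y z))"

lemma bilinear_map_swap: "bilinear_map R M N P f \<Longrightarrow> bilinear_map R N M P (\<lambda>y x. f x y)"
  unfolding bilinear_map_def by blast

text \<open>Stating trilinearity through pairs of variables makes it visibly symmetric. The two
  adjacent swaps generate all reorderings of three variables.\<close>

lemma trilinear_map_swaps:
  assumes "trilinear_map R M N P Q f"
  shows "trilinear_map R N M P Q (\<lambda>x y z. f y x z)" and "trilinear_map R M P N Q (\<lambda>x y z. f x z y)"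
  using assms unfolding trilinear_map_def by (auto intro: bilinear_map_swap)

lemma trilinear_curry_last:
  assumes "module R P" "trilinear_map R M N P Q f"
  shows "bilinear_map R M N (hom_module R P Q) (\<lambda>x y. \<lambda>z\<in>carrier P. f x y z)"
proof -
  interpret P: module R P by fact
  show ?thesis
    using assms(2) unfolding trilinear_map_def bilinear_map_def hom_module_def lin_hom_def
    by (auto simp: PiE_iff fun_eq_iff)
qed

text \<open>Freezing one factor leaves a linear map in the other, to which uniqueness applies again
  when that other factor is itself a tensor product.\<close>

lemma tensor_hom_section_left:
  assumes "module R M" "module R N" "h \<in> lin_hom R (tensor_product R M N) Q" "y \<in> carrier N"
  shows "(\<lambda>x\<in>carrier M. h (tensor_elt R M N x y)) \<in> lin_hom R M Q"
proof -
  interpret M: module R M by fact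
  show ?thesis
    using bilinear_map_compose[OF tensor_universal(2)[OF assms(1,2)] assms(3)] assms(4)
    unfolding bilinear_map_def lin_hom_def by (auto simp: PiE_iff)
qed

lemma tensor_hom_section_right:
  assumes "module R M" "module R N" "h \<in> lin_hom R (tensor_product R M N) Q" "x \<in> carrier M"
  shows "(\<lambda>y\<in>carrier N. h (tensor_elt R M N x y)) \<in> lin_hom R N Q"
proof -
  interpret N: module R N by fact
  show ?thesis
    using bilinear_map_compose[OF tensor_universal(2)[OF assms(1,2)] assms(3)] assms(4)
    unfolding bilinear_map_def lin_hom_def by (auto simp: PiE_iff)
qed

text \<open>Uniqueness is used twice: for fixed \<open>z\<close> the sections of \<open>g\<close>
  and \<open>h\<close> agree on pure tensors of \<open>M\<close> and \<open>N\<close>, hence on all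
  of their tensor product; then \<open>g\<close> and \<open>h\<close> agree on all pure tensors with
  \<open>P\<close>.\<close>

lemma tensor_hom_eqI_left:
  assumes M: "module R M" and N: "module R N" and P: "module R P" and Q: "module R Q"
    and g: "g \<in> lin_hom R (tensor_product R (tensor_product R M N) P) Q"
    and h: "h \<in> lin_hom R (tensor_product R (tensor_product R M N) P) Q"
    and eq: "\<And>x y z. x \<in> carrier M \<Longrightarrow> y \<in> carrier N \<Longrightarrow> z \<in> carrier P \<Longrightarrow>
      g (tensor_elt R (tensor_product R M N) P (tensor_elt R M N x y) z) =
      h (tensor_elt R (tensor_product R M N) P (tensor_elt R M N x y) z)"
  shows "g = h"
proof (rule tensor_hom_eqI[OF tensor_universal(1)[OF M N] P Q g h])
  let ?T = "tensor_product R M N"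
  fix t z assume t: "t \<in> carrier ?T" and z: "z \<in> carrier P"
  note sec = tensor_hom_section_left[OF tensor_universal(1)[OF M N] P _ z]
  have "(\<lambda>t\<in>carrier ?T. g (tensor_elt R ?T P t z)) = (\<lambda>t\<in>carrier ?T. h (tensor_elt R ?T P t z))"
    by (rule tensor_hom_eqI[OF M N Q sec[OF g] sec[OF h]]) (simp add: tensor_elt_closed M N eq z)
  then show "g (tensor_elt R ?T P t z) = h (tensor_elt R ?T P t z)" 
    using t by (auto dest: fun_cong[of _ _ t])
qed

lemma tensor_hom_eqI_right:
  assumes M: "module R M" and N: "module R N" and P: "module R P" and Q: "module R Q"
    and g: "g \<in> lin_hom R (tensor_product R M (tensor_product R N P)) Q"
    and h: "h \<in> lin_hom R (tensor_product R M (tensor_product R N P)) Q"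
    and eq: "\<And>x y z. x \<in> carrier M \<Longrightarrow> y \<in> carrier N \<Longrightarrow> z \<in> carrier P \<Longrightarrow>
      g (tensor_elt R M (tensor_product R N P) x (tensor_elt R N P y z)) =
      h (tensor_elt R M (tensor_product R N P) x (tensor_elt R N P y z))"
  shows "g = h"
proof (rule tensor_hom_eqI[OF M tensor_universal(1)[OF N P] Q g h])
  let ?T = "tensor_product R N P"
  fix x t assume t: "t \<in> carrier ?T" and x: "x \<in> carrier M"
  note sec = tensor_hom_section_right[OF M tensor_universal(1)[OF N P] _ x]
  have "(\<lambda>t\<in>carrier ?T. g (tensor_elt R M ?T x t)) = (\<lambda>t\<in>carrier ?T. h (tensor_elt R M ?T x t))"
    by (rule tensor_hom_eqI[OF N P Q sec[OF g] sec[OF h]]) (simp add: tensor_elt_closed N P eq x)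
  then show "g (tensor_elt R M ?T x t) = h (tensor_elt R M ?T x t)" 
    using t by (auto dest: fun_cong[of _ _ t])
qed

lemma bilinear_uncurry:
  assumes "module R M" "module R N" "H \<in> lin_hom R M (hom_module R N Q)"
  shows "bilinear_map R M N Q (\<lambda>x y. H x y)"
proof -
  interpret M: module R M by fact
  interpret N: module R N by fact
  have H: "H x \<in> lin_hom R N Q" if "x \<in> carrier M" for x
    using lin_hom_closed[OF assms(3) that] by simp
  show ?thesis
    unfolding bilinear_map_def
    by (auto simp: lin_hom_add[OF assms(3)] lin_hom_smult[OF assms(3)] hom_module_add hom_module_smult
        lin_hom_closed[OF H] lin_hom_add[OF H] lin_hom_smult[OF H])
qed

text \<open>
  Currying one variable turns a trilinear map into a bilinear map with values in a module of
  linear maps, which extends to a tensor product by the universal property.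
\<close>

lemma tensor_universal_left:
  assumes M: "module R M" and N: "module R N" and P: "module R P" and Q: "module R Q"
    and f: "trilinear_map R M N P Q f"
  shows "\<exists>!h. h \<in> lin_hom R (tensor_product R (tensor_product R M N) P) Q \<and>
    (\<forall>x\<in>carrier M. \<forall>y\<in>carrier N. \<forall>z\<in>carrier P.
      h (tensor_elt R (tensor_product R M N) P (tensor_elt R M N x y) z) = f x y z)"
proof -
  let ?T = "tensor_product R M N"
  obtain H where H: "H \<in> lin_hom R ?T (hom_module R P Q)"
    "\<And>x y. x \<in> carrier M \<Longrightarrow> y \<in> carrier N \<Longrightarrow> H (tensor_elt R M N x y) = (\<lambda>z\<in>carrier P. f x y z)"
    using tensor_universal(3)[OF M N module_hom_module[OF P Q] trilinear_curry_last[OF P f]] by blast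
  obtain h where h: "h \<in> lin_hom R (tensor_product R ?T P) Q"
    "\<And>t z. t \<in> carrier ?T \<Longrightarrow> z \<in> carrier P \<Longrightarrow> h (tensor_elt R ?T P t z) = H t z"
    using tensor_universal(3)[OF tensor_universal(1)[OF M N] P Q
        bilinear_uncurry[OF tensor_universal(1)[OF M N] P H(1)]] by blast
  show ?thesis
  proof (rule ex1I[of _ h])
    show "h \<in> lin_hom R (tensor_product R ?T P) Q \<and> (\<forall>x\<in>carrier M. \<forall>y\<in>carrier N. \<forall>z\<in>carrier P.
        h (tensor_elt R ?T P (tensor_elt R M N x y) z) = f x y z)"
      by (simp add: h H tensor_elt_closed M N)
  next
    fix g assume "g \<in> lin_hom R (tensor_product R ?T P) Q \<and> (\<forall>x\<in>carrier M. \<forall>y\<in>carrier N. \<forall>z\<in>carrier P.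
        g (tensor_elt R ?T P (tensor_elt R M N x y) z) = f x y z)"
    then show "g = h"
      by (intro tensor_hom_eqI_left[OF M N P Q _ h(1)]) (simp_all add: h H tensor_elt_closed M N)
  qed
qed

lemma tensor_universal_right:
  assumes M: "module R M" and N: "module R N" and P: "module R P" and Q: "module R Q"
    and f: "trilinear_map R M N P Q f"
  shows "\<exists>!h. h \<in> lin_hom R (tensor_product R M (tensor_product R N P)) Q \<and>
    (\<forall>x\<in>carrier M. \<forall>y\<in>carrier N. \<forall>z\<in>carrier P.
      h (tensor_elt R M (tensor_product R N P) x (tensor_elt R N P y z)) = f x y z)"
proof -
  let ?T = "tensor_product R N P"
  \<comment> \<open>The variable to be curried has to come last, so \<open>x\<close> is rotated
    behind \<open>y\<close> and \<open>z\<close>, which form the inner tensor product here.\<close>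
  have f': "trilinear_map R N P M Q (\<lambda>y z x. f x y z)"
    using trilinear_map_swaps(2)[OF trilinear_map_swaps(1)[OF f]] .
  obtain H where H: "H \<in> lin_hom R ?T (hom_module R M Q)"
    "\<And>y z. y \<in> carrier N \<Longrightarrow> z \<in> carrier P \<Longrightarrow> H (tensor_elt R N P y z) = (\<lambda>x\<in>carrier M. f x y z)"
    using tensor_universal(3)[OF N P module_hom_module[OF M Q] trilinear_curry_last[OF M f']] by blast
  obtain h where h: "h \<in> lin_hom R (tensor_product R M ?T) Q"
    "\<And>t x. t \<in> carrier ?T \<Longrightarrow> x \<in> carrier M \<Longrightarrow> h (tensor_elt R M ?T x t) = H t x"
    using tensor_universal(3)[OF M tensor_universal(1)[OF N P] Q
        bilinear_map_swap[OF bilinear_uncurry[OF tensor_universal(1)[OF N P] M H(1)]]] by blast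
  show ?thesis
  proof (rule ex1I[of _ h])
    show "h \<in> lin_hom R (tensor_product R M ?T) Q \<and> (\<forall>x\<in>carrier M. \<forall>y\<in>carrier N. \<forall>z\<in>carrier P.
        h (tensor_elt R M ?T x (tensor_elt R N P y z)) = f x y z)"
      by (simp add: h H tensor_elt_closed N P)
  next
    fix g assume "g \<in> lin_hom R (tensor_product R M ?T) Q \<and> (\<forall>x\<in>carrier M. \<forall>y\<in>carrier N. \<forall>z\<in>carrier P.
        g (tensor_elt R M ?T x (tensor_elt R N P y z)) = f x y z)"
    then show "g = h"
      by (intro tensor_hom_eqI_right[OF M N P Q _ h(1)]) (simp_all add: h H tensor_elt_closed N P)
  qed
qed

lemma trilinear_tensor_left:
  assumes M: "module R M" and N: "module R N" and P: "module R P"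
  shows "trilinear_map R M N P (tensor_product R (tensor_product R M N) P)
    (\<lambda>x y z. tensor_elt R (tensor_product R M N) P (tensor_elt R M N x y) z)"
  using tensor_universal(2)[OF M N] tensor_universal(2)[OF tensor_universal(1)[OF M N] P]
  unfolding trilinear_map_def bilinear_map_def by simp

lemma trilinear_tensor_right:
  assumes M: "module R M" and N: "module R N" and P: "module R P"
  shows "trilinear_map R M N P (tensor_product R M (tensor_product R N P))
    (\<lambda>x y z. tensor_elt R M (tensor_product R N P) x (tensor_elt R N P y z))"
  using tensor_universal(2)[OF N P] tensor_universal(2)[OF M tensor_universal(1)[OF N P]]
  unfolding trilinear_map_def bilinear_map_def by simp


section \<open>Tensor cubes\<close>

lemma module_tensor_square: "module R N \<Longrightarrow> module R (tensor_square R N)"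
  unfolding tensor_square_def by (rule tensor_universal(1))

lemma module_tensor_cube: "module R N \<Longrightarrow> module R (tensor_cube R N)"
  unfolding tensor_cube_def by (intro tensor_universal(1) module_tensor_square)

lemma tensor_elt3_closed:
  "module R N \<Longrightarrow> x \<in> carrier N \<Longrightarrow> y \<in> carrier N \<Longrightarrow> z \<in> carrier N \<Longrightarrow>
    tensor_elt3 R N x y z \<in> carrier (tensor_cube R N)"
  unfolding tensor_cube_def tensor_elt3_def tensor_square_def
  by (intro tensor_elt_closed tensor_universal(1))

lemma cube_hom_eqI:
  assumes N: "module R N" and Q: "module R Q"
    and g: "g \<in> lin_hom R (tensor_cube R N) Q" and h: "h \<in> lin_hom R (tensor_cube R N) Q"
    and eq: "\<And>x y z. x \<in> carrier N \<Longrightarrow> y \<in> carrier N \<Longrightarrow> z \<in> carrier N \<Longrightarrow>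
      g (tensor_elt3 R N x y z) = h (tensor_elt3 R N x y z)"
  shows "g = h"
  using assms unfolding tensor_cube_def tensor_elt3_def tensor_square_def
  by (intro tensor_hom_eqI_left[OF N N N Q])

text \<open>The left-nested triple tensor is trilinear in its entries, so it factors through the
  right-nested cube. The opposite map arises with the two nestings exchanged.\<close>

lemma assoc_to_left:
  assumes N: "module R N"
  shows "assoc_to_left R N \<in> lin_hom R (tensor_product R N (tensor_square R N)) (tensor_cube R N)"
    and "\<And>x y z. x \<in> carrier N \<Longrightarrow> y \<in> carrier N \<Longrightarrow> z \<in> carrier N \<Longrightarrow>
      assoc_to_left R N (tensor_elt R N (tensor_square R N) x (tensor_elt R N N y z)) = tensor_elt3 R N x y z"
  using the_homI[OF tensor_universal_right[OF N N N _ trilinear_tensor_left[OF N N N]]] module_tensor_cube[OF N]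
  unfolding assoc_to_left_def tensor_cube_def tensor_elt3_def tensor_square_def by simp_all

lemma assoc_to_right:
  assumes N: "module R N"
  shows "assoc_to_right R N \<in> lin_hom R (tensor_cube R N) (tensor_product R N (tensor_square R N))"
    and "\<And>x y z. x \<in> carrier N \<Longrightarrow> y \<in> carrier N \<Longrightarrow> z \<in> carrier N \<Longrightarrow>
      assoc_to_right R N (tensor_elt3 R N x y z) = tensor_elt R N (tensor_square R N) x (tensor_elt R N N y z)"
  using the_homI[OF tensor_universal_left[OF N N N _ trilinear_tensor_right[OF N N N]]]
    tensor_universal(1)[OF N tensor_universal(1)[OF N N]]
  unfolding assoc_to_right_def tensor_cube_def tensor_elt3_def tensor_square_def by simp_all


section \<open>The symmetric group on three letters\<close>

text \<open>Lists the six possible value triples, so that claims about an arbitrary permutation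
  become six computations.\<close>

lemma permutes_123_cases:
  assumes "p permutes {1, 2, 3::nat}"
  shows "(p 1, p 2, p 3) \<in> {(1,2,3), (1,3,2), (2,1,3), (2,3,1), (3,1,2), (3,2,1)}"
proof -
  have *: "(a, b, c) \<in> {(1,2,3), (1,3,2), (2,1,3), (2,3,1), (3,1,2), (3,2,1)}"
    if "a \<in> {1,2,3}" "b \<in> {1,2,3}" "c \<in> {1,2,3}" "a \<noteq> b" "a \<noteq> c" "b \<noteq> c" for a b c :: nat
    using that by (elim insertE emptyE) simp_all
  have "p 1 \<in> {1,2,3}" "p 2 \<in> {1,2,3}" "p 3 \<in> {1,2,3}"
    using permutes_in_image[OF assms, of 1] permutes_in_image[OF assms, of 2]
      permutes_in_image[OF assms, of 3] by simp_all
  moreover have "p 1 \<noteq> p 2" "p 1 \<noteq> p 3" "p 2 \<noteq> p 3"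
    using permutes_inj[OF assms] by (simp_all add: inj_eq)
  ultimately show ?thesis by (rule *)
qed

lemma sub_S3_permutes: "\<sigma> \<in> sub_S3 i \<Longrightarrow> \<sigma> permutes {1, 2, 3}"
  unfolding sub_S3_def
  by (simp split: if_splits; elim disjE; simp add: permutes_id permutes_swap_id permutes_compose)

lemma finite_sub_S3: "finite (sub_S3 i)"
proof (rule finite_subset)
  show "sub_S3 i \<subseteq> {\<sigma>. \<sigma> permutes {1, 2, 3}}" using sub_S3_permutes by blast
qed (rule finite_permutations, simp)

text \<open>Transpositions are their own inverses, and the two 3-cycles, written as products of the
  same transpositions in opposite orders, are inverse to each other.\<close>

lemma sub_S3_inv: "\<sigma> \<in> sub_S3 i \<Longrightarrow> inv_into UNIV \<sigma> \<in> sub_S3 i"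
  unfolding sub_S3_def by (auto split: if_splits simp: o_inv_distrib permutes_inv)

lemma bij_betw_inv_sub_S3: "bij_betw (inv_into UNIV) (sub_S3 i) (sub_S3 i)"
  by (rule bij_betw_byWitness[where f' = "inv_into UNIV"])
    (auto simp: sub_S3_inv permutes_inv_inv[OF sub_S3_permutes])

text \<open>Permuting the entries of a pure tensor is trilinear in those entries, so the universal
  property of the cube shows that the description defining \<open>Phi\<close> is met by exactly one
  linear map.\<close>

lemma Phi:
  fixes N :: "('r, 'n, 'z) module_scheme" and \<sigma> :: "nat \<Rightarrow> nat"
  assumes N: "module R N" and \<sigma>: "\<sigma> permutes {1, 2, 3}"
  shows "Phi R N \<sigma> \<in> lin_hom R (tensor_cube R N) (tensor_cube R N)"
    and "\<And>x. (\<And>j. j \<in> {1, 2, 3} \<Longrightarrow> x j \<in> carrier N) \<Longrightarrow>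
      Phi R N \<sigma> (tensor_elt3 R N (x 1) (x 2) (x 3)) =
        tensor_elt3 R N (x (inv_into UNIV \<sigma> 1)) (x (inv_into UNIV \<sigma> 2)) (x (inv_into UNIV \<sigma> 3))"
proof -
  \<comment> \<open>Packs three vectors into an indexed family. The final branch stands for index 3;
    other indices never occur, as the permutation preserves {1, 2, 3}.\<close>
  let ?v = "\<lambda>x y z j. if j = 1 then x else if j = (2::nat) then y else z"
  let ?f = "\<lambda>x y z. tensor_elt3 R N (?v x y z (inv_into UNIV \<sigma> 1)) (?v x y z (inv_into UNIV \<sigma> 2)) (?v x y z (inv_into UNIV \<sigma> 3))"
  note t = trilinear_tensor_left[OF N N N, folded tensor_square_def, folded tensor_elt3_def tensor_cube_def]
  note s1 = trilinear_map_swaps(1) and s2 = trilinear_map_swaps(2)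
  \<comment> \<open>The six words in the two adjacent swaps, from the empty word to the one of
    length three, cover the six cases for the inverse of \<open>\<sigma>\<close>.\<close>
  have "trilinear_map R N N N (tensor_cube R N) ?f"
    using permutes_123_cases[OF permutes_inv[OF \<sigma>]] t s1[OF t] s2[OF t] s1[OF s2[OF t]] s2[OF s1[OF t]]
      s1[OF s2[OF s1[OF t]]] by auto
  note u = tensor_universal_left[OF N N N module_tensor_cube[OF N] this,
      folded tensor_square_def, folded tensor_elt3_def tensor_cube_def]
  have v: "?v (x 1) (x 2) (x 3) (inv_into UNIV \<sigma> j) = x (inv_into UNIV \<sigma> j)" if "j \<in> {1, 2, 3}" for j and x :: "nat \<Rightarrow> 'n"
    using permutes_in_image[OF permutes_inv[OF \<sigma>], of j] that by auto
  \<comment> \<open>\<open>Phi\<close> is specified through families indexed by numbers, the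
    universal property through three separate vectors. Only the entries at 1, 2 and 3 matter, so the
    two conditions coincide.\<close>
  have "(\<forall>x\<in>carrier N. \<forall>y\<in>carrier N. \<forall>z\<in>carrier N. h (tensor_elt3 R N x y z) = ?f x y z) \<longleftrightarrow>
      (\<forall>x. (\<forall>j\<in>{1, 2, 3}. x j \<in> carrier N) \<longrightarrow> h (tensor_elt3 R N (x 1) (x 2) (x 3)) =
           tensor_elt3 R N (x (inv_into UNIV \<sigma> 1)) (x (inv_into UNIV \<sigma> 2)) (x (inv_into UNIV \<sigma> 3)))" (is "?L \<longleftrightarrow> ?R") for h
  proof
    assume ?L
    show ?R
    proof (intro allI impI)
      fix x :: "nat \<Rightarrow> 'n" assume "\<forall>j\<in>{1, 2, 3}. x j \<in> carrier N"
      then have "h (tensor_elt3 R N (x 1) (x 2) (x 3)) = ?f (x 1) (x 2) (x 3)"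
        using \<open>?L\<close> by blast
      then show "h (tensor_elt3 R N (x 1) (x 2) (x 3)) =
          tensor_elt3 R N (x (inv_into UNIV \<sigma> 1)) (x (inv_into UNIV \<sigma> 2)) (x (inv_into UNIV \<sigma> 3))"
        by (simp only: v insert_iff simp_thms)
    qed
  next
    assume ?R
    show ?L
    proof (intro ballI)
      fix x y z assume "x \<in> carrier N" "y \<in> carrier N" "z \<in> carrier N"
      then show "h (tensor_elt3 R N x y z) = ?f x y z"
        using \<open>?R\<close>[rule_format, of "?v x y z"] by simp
    qed
  qed
  note the_homI[OF u[unfolded this], folded Phi_def]
  then show "Phi R N \<sigma> \<in> lin_hom R (tensor_cube R N) (tensor_cube R N)"
    "\<And>x. (\<And>j. j \<in> {1, 2, 3} \<Longrightarrow> x j \<in> carrier N) \<Longrightarrow>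
      Phi R N \<sigma> (tensor_elt3 R N (x 1) (x 2) (x 3)) =
        tensor_elt3 R N (x (inv_into UNIV \<sigma> 1)) (x (inv_into UNIV \<sigma> 2)) (x (inv_into UNIV \<sigma> 3))"
    by blast+
qed

lemma Phi_sum_lin:
  assumes "module R N"
  shows "Phi_sum R N i \<in> lin_hom R (tensor_cube R N) (tensor_cube R N)"
proof -
  interpret H: module R "hom_module R (tensor_cube R N) (tensor_cube R N)"
    by (intro module_hom_module module_tensor_cube assms)
  show ?thesis
    unfolding Phi_sum_def carrier_hom_module[symmetric]
    using Phi(1)[OF assms sub_S3_permutes]
    by (intro H.finsum_closed) (auto simp del: carrier_hom_module simp: carrier_hom_module[symmetric])
qed

text \<open>Inversion is a sign-preserving bijection of \<open>sub_S3 i\<close>, so the sum may be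
  reindexed by it. This absorbs the inverse that appears when a permutation is moved from
  functionals to arguments.\<close>

lemma signed_sum_inverse:
  assumes "abelian_group A" "K \<in> sub_S3 i \<rightarrow> carrier A"
    and "\<And>\<sigma>. \<sigma> \<in> sub_S3 i \<Longrightarrow> F \<sigma> = K (inv_into UNIV \<sigma>)"
  shows "(\<Oplus>\<^bsub>A\<^esub>\<sigma>\<in>sub_S3 i. add_pow A (sign \<sigma>) (F \<sigma>)) = (\<Oplus>\<^bsub>A\<^esub>\<sigma>\<in>sub_S3 i. add_pow A (sign \<sigma>) (K \<sigma>))"
proof -
  interpret A: abelian_group A by fact
  note bij = bij_betw_inv_sub_S3[of i]
  have "(\<Oplus>\<^bsub>A\<^esub>\<sigma>\<in>sub_S3 i. add_pow A (sign \<sigma>) (F \<sigma>)) =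
      (\<Oplus>\<^bsub>A\<^esub>\<sigma>\<in>sub_S3 i. add_pow A (sign (inv_into UNIV \<sigma>)) (K (inv_into UNIV \<sigma>)))"
    using assms(2) sub_S3_inv
    by (intro A.finsum_cong')
      (auto simp: assms(3) sign_inverse permutes_imp_permutation[OF _ sub_S3_permutes])
  also have "\<dots> = (\<Oplus>\<^bsub>A\<^esub>\<sigma>\<in>inv_into UNIV ` sub_S3 i. add_pow A (sign \<sigma>) (K \<sigma>))"
    by (rule A.finsum_reindex[symmetric]) (use assms(2) bij in \<open>auto simp: bij_betw_def\<close>)
  also have "inv_into UNIV ` sub_S3 i = sub_S3 i"
    using bij by (rule bij_betw_imp_surj_on)
  finally show ?thesis .
qed


section \<open>Products of linear functionals\<close>

lemma regular_module_sel [simp]: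
  "carrier (regular_module R) = carrier R"
  "add (regular_module R) = add R"
  "smult (regular_module R) = monoid.mult R"
  by (simp_all add: regular_module_def)

lemma mult_map:
  assumes "cring R"
  shows "mult_map R \<in> lin_hom R (tensor_square R (regular_module R)) (regular_module R)"
    and "\<And>a b. a \<in> carrier R \<Longrightarrow> b \<in> carrier R \<Longrightarrow>
      mult_map R (tensor_elt R (regular_module R) (regular_module R) a b) = a \<otimes>\<^bsub>R\<^esub> b"
proof -
  interpret cring R by fact
  note reg = module_regular[OF assms]
  have "bilinear_map R (regular_module R) (regular_module R) (regular_module R) (\<otimes>\<^bsub>R\<^esub>)"
    unfolding bilinear_map_def by (simp add: l_distr r_distr m_ac)
  note the_tensor_hom[OF reg reg reg this, folded tensor_square_def, simplified, folded mult_map_def]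
  then show "mult_map R \<in> lin_hom R (tensor_square R (regular_module R)) (regular_module R)"
    "\<And>a b. a \<in> carrier R \<Longrightarrow> b \<in> carrier R \<Longrightarrow>
      mult_map R (tensor_elt R (regular_module R) (regular_module R) a b) = a \<otimes>\<^bsub>R\<^esub> b" by auto
qed

text \<open>This is the functional sending a pure tensor of \<open>x\<close> and \<open>y\<close> to
  the product of \<open>f x\<close> and \<open>g y\<close>. Two different modules are allowed so
  that the construction can be iterated with a tensor square as one factor.\<close>

definition tensor_functional ::
    "('r, 'x) ring_scheme \<Rightarrow> ('r, 'm, 'y) module_scheme \<Rightarrow> ('r, 'n, 'z) module_scheme
      \<Rightarrow> ('m \<Rightarrow> 'r) \<Rightarrow> ('n \<Rightarrow> 'r) \<Rightarrow> ('m \<times> 'n \<Rightarrow> 'r) set \<Rightarrow> 'r"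
  where "tensor_functional R M N f g = compose (carrier (tensor_product R M N)) (mult_map R)
    (tensor_map R M N (regular_module R) (regular_module R) f g)"

lemma tensor_functional:
  assumes "cring R" "module R M" "module R N"
    and f: "f \<in> lin_hom R M (regular_module R)" and g: "g \<in> lin_hom R N (regular_module R)"
  shows "tensor_functional R M N f g \<in> lin_hom R (tensor_product R M N) (regular_module R)"
    and "\<And>x y. x \<in> carrier M \<Longrightarrow> y \<in> carrier N \<Longrightarrow>
      tensor_functional R M N f g (tensor_elt R M N x y) = f x \<otimes>\<^bsub>R\<^esub> g y"
proof -
  note reg = module_regular[OF assms(1)]
  note t = tensor_map[OF assms(2,3) reg reg f g]
  show "tensor_functional R M N f g \<in> lin_hom R (tensor_product R M N) (regular_module R)"
    unfolding tensor_functional_def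
    using lin_hom_compose[OF tensor_universal(1)[OF assms(2,3)] t(1) mult_map(1)[OF assms(1), unfolded tensor_square_def]] .
  show "tensor_functional R M N f g (tensor_elt R M N x y) = f x \<otimes>\<^bsub>R\<^esub> g y"
    if "x \<in> carrier M" "y \<in> carrier N" for x y
    using that lin_hom_closed[OF f] lin_hom_closed[OF g]
    by (simp add: tensor_functional_def compose_eq tensor_elt_closed assms t(2) mult_map(2))
qed

text \<open>\<open>lambda2\<close> is the linear extension of the bilinear map
  \<open>tensor_map\<close>. Its definition only prescribes values on pure tensors of
  \<open>M\<close>, but those determine the resulting maps.\<close>

lemma lambda2_tensor_elt:
  assumes "cring R" "module R M"
    and f: "f \<in> carrier (dual_module R M)" and g: "g \<in> carrier (dual_module R M)"
  shows "lambda2 R M (tensor_elt R (dual_module R M) (dual_module R M) f g) =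
    tensor_map R M M (regular_module R) (regular_module R) f g"
proof -
  let ?D = "dual_module R M" and ?Reg = "regular_module R"
  note reg = module_regular[OF assms(1)] and M = assms(2)
  note D = module_hom_module[OF M reg, folded dual_module_def]
  have H: "module R (hom_module R (tensor_square R M) (tensor_square R ?Reg))"
    by (intro module_hom_module module_tensor_square reg M)
  note u = tensor_universal(3)[OF D D H, folded tensor_square_def,
      OF tensor_map_bilinear[OF M M reg reg, folded dual_module_def tensor_square_def]]
  \<comment> \<open>Both descriptions single out the same maps \<open>h\<close>, so the universal
    property for the first resolves the definite description made from the second.\<close>
  have eq: "h \<in> lin_hom R (tensor_square R ?D) (hom_module R (tensor_square R M) (tensor_square R ?Reg)) \<and>
       (\<forall>f\<in>carrier ?D. \<forall>g\<in>carrier ?D. h (tensor_elt R ?D ?D f g) = tensor_map R M M ?Reg ?Reg f g)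
    \<longleftrightarrow> h \<in> lin_hom R (tensor_square R ?D) (hom_module R (tensor_square R M) (tensor_square R ?Reg)) \<and>
      (\<forall>f\<in>carrier ?D. \<forall>g\<in>carrier ?D. \<forall>x\<in>carrier M. \<forall>y\<in>carrier M.
        h (tensor_elt R ?D ?D f g) (tensor_elt R M M x y) = tensor_elt R ?Reg ?Reg (f x) (g y))" (is "?L \<longleftrightarrow> ?R") for h
  proof
    assume ?L
    then show ?R by (simp add: tensor_map(2)[OF M M reg reg] dual_module_def)
  next
    assume r: ?R
    have "h (tensor_elt R ?D ?D f g) = tensor_map R M M ?Reg ?Reg f g"
      if f: "f \<in> carrier ?D" and g: "g \<in> carrier ?D" for f g
    proof (rule tensor_hom_eqI[OF M M tensor_universal(1)[OF reg reg]])
      have "h (tensor_elt R ?D ?D f g) \<in> carrier (hom_module R (tensor_square R M) (tensor_square R ?Reg))"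
        using r tensor_elt_closed[OF D D f g] by (intro lin_hom_closed[of h R]) (auto simp: tensor_square_def)
      then show "h (tensor_elt R ?D ?D f g) \<in> lin_hom R (tensor_product R M M) (tensor_product R ?Reg ?Reg)"
        by (simp add: tensor_square_def)
    qed (use r f g in \<open>simp_all add: tensor_map[OF M M reg reg] dual_module_def\<close>)
    with r show ?L by blast
  qed
  from the_homI(2)[OF u] show ?thesis
    unfolding lambda2_def the_hom_def eq[symmetric] using f g by blast
qed


section \<open>The dual algebra\<close>

context
  fixes R :: "('r, 'x) ring_scheme" and M :: "('r, 'm, 'y) module_scheme"
    and \<Delta> :: "'m \<Rightarrow> ('m \<times> 'm \<Rightarrow> 'r) set"
  assumes cring: "cring R" and M: "module R M" and Delta: "\<Delta> \<in> lin_hom R M (tensor_square R M)"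
begin

abbreviation (input) "D \<equiv> dual_module R M"
abbreviation (input) "Reg \<equiv> regular_module R"

lemma module_reg: "module R Reg"
  using cring by (rule module_regular)

lemma module_dual: "module R D"
  unfolding dual_module_def using M module_reg by (rule module_hom_module)

lemma carrier_dual: "carrier D = lin_hom R M Reg"
  by (simp add: dual_module_def)

lemma Delta_closed: "m \<in> carrier M \<Longrightarrow> \<Delta> m \<in> carrier (tensor_product R M M)"
  using lin_hom_closed[OF Delta] by (simp add: tensor_square_def)

lemma module_square: "module R (tensor_product R M M)"
  using M by (intro tensor_universal(1))

section \<open>The convolution product on the dual\<close>

lemma convolution_eq:
  assumes "f \<in> carrier D" "g \<in> carrier D"
  shows "convolution R M \<Delta> f g = compose (carrier M) (tensor_functional R M M f g) \<Delta>"
  unfolding convolution_def lambda2_tensor_elt[OF cring M assms] tensor_functional_def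
  by (auto simp: compose_def Delta_closed)

lemma convolution_closed:
  assumes "f \<in> carrier D" "g \<in> carrier D"
  shows "convolution R M \<Delta> f g \<in> carrier D"
  unfolding convolution_eq[OF assms] carrier_dual
  using lin_hom_compose[OF M Delta[unfolded tensor_square_def] tensor_functional(1)[OF cring M M]] assms
  by (simp add: carrier_dual)

lemma convolution_apply:
  assumes "f \<in> carrier D" "g \<in> carrier D" "m \<in> carrier M"
  shows "convolution R M \<Delta> f g m = tensor_functional R M M f g (\<Delta> m)"
  using assms by (simp add: convolution_eq compose_eq)

text \<open>Convolution is the bilinear \<open>tensor_map\<close> followed by two linear operations
  on Hom modules: precomposition with \<open>\<Delta>\<close> and postcomposition with
  \<open>mult_map R\<close>.\<close>

lemma convolution_bilinear: "bilinear_map R D D D (convolution R M \<Delta>)"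
proof -
  note sq = module_tensor_square[OF module_reg]
  have "bilinear_map R D D D
    (\<lambda>f g. compose (carrier M) (mult_map R) (compose (carrier M) (tensor_map R M M Reg Reg f g) \<Delta>))"
    using tensor_map_bilinear[OF M M module_reg module_reg, folded dual_module_def tensor_square_def]
    by (intro bilinear_postcompose[OF module_dual module_dual M sq mult_map(1)[OF cring], folded dual_module_def]
        bilinear_precompose[OF module_dual module_dual M _ sq Delta] module_tensor_square M)
  then show ?thesis
    by (rule bilinear_map_cong[OF module_dual module_dual])
      (simp add: convolution_def lambda2_tensor_elt[OF cring M])
qed

lemma dual_mult_lin: "dual_mult R M \<Delta> \<in> lin_hom R (tensor_product R D D) D"
  using the_tensor_hom(1)[OF module_dual module_dual module_dual convolution_bilinear]
  unfolding dual_mult_def tensor_square_def .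

lemma dual_mult_tensor_elt:
  "f \<in> carrier D \<Longrightarrow> g \<in> carrier D \<Longrightarrow> dual_mult R M \<Delta> (tensor_elt R D D f g) = convolution R M \<Delta> f g"
  using the_tensor_hom(2)[OF module_dual module_dual module_dual convolution_bilinear]
  unfolding dual_mult_def tensor_square_def .

section \<open>Threefold products of functionals and iterated convolutions\<close>

definition tensor_functional3 where
  "tensor_functional3 f g h =
    tensor_functional R (tensor_product R M M) M (tensor_functional R M M f g) h"

lemma tensor_functional3:
  assumes f: "f \<in> carrier D" and g: "g \<in> carrier D" and h: "h \<in> carrier D"
  shows "tensor_functional3 f g h \<in> lin_hom R (tensor_cube R M) Reg"
    and "\<And>x y z. x \<in> carrier M \<Longrightarrow> y \<in> carrier M \<Longrightarrow> z \<in> carrier M \<Longrightarrow>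
      tensor_functional3 f g h (tensor_elt3 R M x y z) = f x \<otimes>\<^bsub>R\<^esub> g y \<otimes>\<^bsub>R\<^esub> h z"
  using assms unfolding tensor_functional3_def tensor_cube_def tensor_square_def tensor_elt3_def carrier_dual
  by (simp_all add: tensor_functional cring M module_square tensor_elt_closed)

text \<open>The inner convolution contributes a \<open>\<Delta>\<close> in the first factor, which
  can be split off as \<open>tensor_map\<close> of \<open>\<Delta>\<close> and the identity, leaving
  the threefold product of functionals.\<close>

lemma convolution_convolution_left:
  assumes f: "f \<in> carrier D" and g: "g \<in> carrier D" and h: "h \<in> carrier D" and m: "m \<in> carrier M"
  shows "convolution R M \<Delta> (convolution R M \<Delta> f g) h m =
    tensor_functional3 f g h (tensor_map R M M (tensor_square R M) M \<Delta> (id_hom M) (\<Delta> m))"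
proof -
  let ?S = "tensor_square R M"
  note S = module_tensor_square[OF M]
  note t = tensor_map[OF M M S M Delta id_hom_lin[OF M]]
  note c = convolution_closed[OF f g]
  \<comment> \<open>The factorisation is proved for maps on the whole tensor square, by checking
    pure tensors, because \<open>\<Delta> m\<close> itself need not be pure.\<close>
  have "tensor_functional R M M (convolution R M \<Delta> f g) h =
    compose (carrier (tensor_product R M M)) (tensor_functional3 f g h)
      (tensor_map R M M ?S M \<Delta> (id_hom M))"
  proof (rule tensor_hom_eqI[OF M M module_reg])
    show "tensor_functional R M M (convolution R M \<Delta> f g) h \<in> lin_hom R (tensor_product R M M) Reg"
      using tensor_functional(1)[OF cring M M] c h by (simp add: carrier_dual)
    show "compose (carrier (tensor_product R M M)) (tensor_functional3 f g h)
        (tensor_map R M M ?S M \<Delta> (id_hom M)) \<in> lin_hom R (tensor_product R M M) Reg"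
      using lin_hom_compose[OF module_square t(1) tensor_functional3(1)[OF f g h, unfolded tensor_cube_def]] .
    show "tensor_functional R M M (convolution R M \<Delta> f g) h (tensor_elt R M M x y) =
        compose (carrier (tensor_product R M M)) (tensor_functional3 f g h)
          (tensor_map R M M ?S M \<Delta> (id_hom M)) (tensor_elt R M M x y)"
      if x: "x \<in> carrier M" and y: "y \<in> carrier M" for x y
      using x y f g h c Delta_closed[OF x]
      by (simp add: compose_eq tensor_elt_closed M t(2)[unfolded tensor_square_def] tensor_functional3_def tensor_functional cring module_square
          carrier_dual tensor_square_def id_hom_apply convolution_apply)
  qed
  then show ?thesis
    using c h m by (simp add: convolution_apply compose_eq Delta_closed)
qed

text \<open>Splitting off \<open>\<Delta>\<close> in the second factor yields a functional on the
  right-nested cube, which is then transported to the left-nested one.\<close>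

lemma convolution_convolution_right:
  assumes f: "f \<in> carrier D" and g: "g \<in> carrier D" and h: "h \<in> carrier D" and m: "m \<in> carrier M"
  shows "convolution R M \<Delta> f (convolution R M \<Delta> g h) m =
    tensor_functional3 f g h (assoc_to_left R M
      (tensor_map R M M M (tensor_square R M) (id_hom M) \<Delta> (\<Delta> m)))"
proof -
  let ?S = "tensor_square R M"
  interpret cring R by (rule cring)
  note S = module_tensor_square[OF M]
  note t = tensor_map[OF M M M S id_hom_lin[OF M] Delta]
  note c = convolution_closed[OF g h]
  have cl: "f x \<in> carrier R" "g x \<in> carrier R" "h x \<in> carrier R" if "x \<in> carrier M" for x
    using that f g h lin_hom_closed[of _ R M Reg x] by (auto simp: carrier_dual)
  \<comment> \<open>Associativity of multiplication in \<open>R\<close> makes the two bracketings of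
    the threefold product correspond under \<open>assoc_to_left\<close>.\<close>
  have assoc: "tensor_functional R M ?S f (tensor_functional R M M g h) =
    compose (carrier (tensor_product R M ?S)) (tensor_functional3 f g h) (assoc_to_left R M)"
    unfolding tensor_square_def
  proof (rule tensor_hom_eqI_right[OF M M M module_reg])
    show "tensor_functional R M (tensor_product R M M) f (tensor_functional R M M g h)
        \<in> lin_hom R (tensor_product R M (tensor_product R M M)) Reg"
      using f g h by (simp add: tensor_functional cring M module_square carrier_dual)
    show "compose (carrier (tensor_product R M (tensor_product R M M))) (tensor_functional3 f g h) (assoc_to_left R M)
        \<in> lin_hom R (tensor_product R M (tensor_product R M M)) Reg"
      using lin_hom_compose[OF tensor_universal(1)[OF M S] assoc_to_left(1)[OF M] tensor_functional3(1)[OF f g h]]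
      unfolding tensor_square_def .
  qed (use f g h in \<open>simp add: compose_eq tensor_elt_closed M module_square tensor_functional cring carrier_dual
      assoc_to_left(2)[unfolded tensor_square_def] tensor_functional3 m_assoc cl\<close>)
  have "tensor_functional R M M f (convolution R M \<Delta> g h) =
    compose (carrier (tensor_product R M M)) (tensor_functional R M ?S f (tensor_functional R M M g h))
      (tensor_map R M M M ?S (id_hom M) \<Delta>)"
  proof (rule tensor_hom_eqI[OF M M module_reg])
    show "tensor_functional R M M f (convolution R M \<Delta> g h) \<in> lin_hom R (tensor_product R M M) Reg"
      using tensor_functional(1)[OF cring M M] c f by (simp add: carrier_dual)
    show "compose (carrier (tensor_product R M M)) (tensor_functional R M ?S f (tensor_functional R M M g h))
        (tensor_map R M M M ?S (id_hom M) \<Delta>) \<in> lin_hom R (tensor_product R M M) Reg"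
      using f g h
      by (intro lin_hom_compose[OF module_square t(1)] tensor_functional(1)[OF cring M S])
        (simp_all add: carrier_dual tensor_functional cring M tensor_square_def)
    show "tensor_functional R M M f (convolution R M \<Delta> g h) (tensor_elt R M M x y) =
        compose (carrier (tensor_product R M M)) (tensor_functional R M ?S f (tensor_functional R M M g h))
          (tensor_map R M M M ?S (id_hom M) \<Delta>) (tensor_elt R M M x y)"
      if x: "x \<in> carrier M" and y: "y \<in> carrier M" for x y
      using x y f g h c Delta_closed[OF y]
      by (simp add: compose_eq tensor_elt_closed M t(2)[unfolded tensor_square_def] tensor_functional cring module_square
          carrier_dual tensor_square_def id_hom_apply convolution_apply)
  qed
  moreover have "tensor_map R M M M ?S (id_hom M) \<Delta> (\<Delta> m) \<in> carrier (tensor_product R M ?S)"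
    using lin_hom_closed[OF t(1) Delta_closed[OF m]] .
  ultimately show ?thesis
    using c f m by (simp add: convolution_apply compose_eq Delta_closed assoc)
qed

section \<open>The associator of the dual and the coassociator\<close>

lemma coassociator:
  shows "coassociator R M \<Delta> \<in> lin_hom R M (tensor_cube R M)"
    and "\<And>m. m \<in> carrier M \<Longrightarrow> coassociator R M \<Delta> m =
      tensor_map R M M (tensor_square R M) M \<Delta> (id_hom M) (\<Delta> m) \<ominus>\<^bsub>tensor_cube R M\<^esub>
      assoc_to_left R M (tensor_map R M M M (tensor_square R M) (id_hom M) \<Delta> (\<Delta> m))"
proof -
  note S = module_tensor_square[OF M] and C = module_tensor_cube[OF M]
  note Delta' = Delta[unfolded tensor_square_def]
  have 1: "compose (carrier M) (tensor_map R M M (tensor_square R M) M \<Delta> (id_hom M)) \<Delta>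
      \<in> lin_hom R M (tensor_cube R M)"
    using lin_hom_compose[OF M Delta' tensor_map(1)[OF M M S M Delta id_hom_lin[OF M]]]
    by (simp add: tensor_cube_def)
  have 2: "compose (carrier M) (assoc_to_left R M)
        (compose (carrier M) (tensor_map R M M M (tensor_square R M) (id_hom M) \<Delta>) \<Delta>)
      \<in> lin_hom R M (tensor_cube R M)"
    using lin_hom_compose[OF M lin_hom_compose[OF M Delta' tensor_map(1)[OF M M M S id_hom_lin[OF M] Delta]]
        assoc_to_left(1)[OF M]] .
  show "coassociator R M \<Delta> \<in> lin_hom R M (tensor_cube R M)"
    unfolding coassociator_def using lin_hom_hom_minus[OF M C 1 2] .
  show "coassociator R M \<Delta> m =
      tensor_map R M M (tensor_square R M) M \<Delta> (id_hom M) (\<Delta> m) \<ominus>\<^bsub>tensor_cube R M\<^esub>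
      assoc_to_left R M (tensor_map R M M M (tensor_square R M) (id_hom M) \<Delta> (\<Delta> m))"
    if "m \<in> carrier M" for m
    unfolding coassociator_def hom_module_minus[OF M C 1 2 that] by (simp add: compose_eq that)
qed

text \<open>On a pure tensor the two terms of the associator are the two bracketings of an iterated
  convolution. Both are values of one functional on the cube, so linearity gathers their difference
  into the coassociator.\<close>

lemma associator_dual_mult:
  shows "associator R D (dual_mult R M \<Delta>) \<in> lin_hom R (tensor_cube R D) D"
    and "\<And>f g h m. f \<in> carrier D \<Longrightarrow> g \<in> carrier D \<Longrightarrow> h \<in> carrier D \<Longrightarrow> m \<in> carrier M \<Longrightarrow>
      associator R D (dual_mult R M \<Delta>) (tensor_elt3 R D f g h) m =
        tensor_functional3 f g h (coassociator R M \<Delta> m)"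
proof -
  let ?S = "tensor_square R D" and ?C = "tensor_cube R D" and ?\<mu> = "dual_mult R M \<Delta>"
  note S = module_tensor_square[OF module_dual] and C = module_tensor_cube[OF module_dual]
  note \<mu> = dual_mult_lin[folded tensor_square_def]
  note t1 = tensor_map[OF S module_dual module_dual module_dual \<mu> id_hom_lin[OF module_dual], folded tensor_square_def tensor_cube_def]
  note t2 = tensor_map[OF module_dual S module_dual module_dual id_hom_lin[OF module_dual] \<mu>, folded tensor_square_def tensor_cube_def]
  have 1: "compose (carrier ?C) ?\<mu> (tensor_map R ?S D D D ?\<mu> (id_hom D)) \<in> lin_hom R ?C D"
    using lin_hom_compose[OF C t1(1) \<mu>] .
  have 2: "compose (carrier ?C) ?\<mu> (compose (carrier ?C) (tensor_map R D ?S D D (id_hom D) ?\<mu>) (assoc_to_right R D))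
      \<in> lin_hom R ?C D"
    using lin_hom_compose[OF C lin_hom_compose[OF C assoc_to_right(1)[OF module_dual] t2(1)] \<mu>] .
  show "associator R D ?\<mu> \<in> lin_hom R ?C D"
    unfolding associator_def using lin_hom_hom_minus[OF C module_dual 1 2] .
  fix f g h m assume f: "f \<in> carrier D" and g: "g \<in> carrier D" and h: "h \<in> carrier D" and m: "m \<in> carrier M"
  let ?l = "tensor_map R M M (tensor_square R M) M \<Delta> (id_hom M) (\<Delta> m)"
  let ?r = "assoc_to_left R M (tensor_map R M M M (tensor_square R M) (id_hom M) \<Delta> (\<Delta> m))"
  have lr: "?l \<in> carrier (tensor_cube R M)" "?r \<in> carrier (tensor_cube R M)"
    using lin_hom_closed[OF tensor_map(1)[OF M M module_tensor_square[OF M] M Delta id_hom_lin[OF M]] Delta_closed[OF m]]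
      lin_hom_closed[OF assoc_to_left(1)[OF M] lin_hom_closed[OF
          tensor_map(1)[OF M M M module_tensor_square[OF M] id_hom_lin[OF M] Delta] Delta_closed[OF m]]]
    by (simp_all add: tensor_cube_def)
  note c = convolution_closed[OF f g] convolution_closed[OF g h]
  note el = tensor_elt_closed[OF module_dual module_dual, folded tensor_square_def]
  have eq: "associator R D ?\<mu> (tensor_elt3 R D f g h) =
      convolution R M \<Delta> (convolution R M \<Delta> f g) h \<ominus>\<^bsub>D\<^esub> convolution R M \<Delta> f (convolution R M \<Delta> g h)"
    unfolding associator_def hom_module_minus[OF C module_dual 1 2 tensor_elt3_closed[OF module_dual f g h]]
    using f g h c
    by (simp add: compose_eq tensor_elt3_closed module_dual assoc_to_right(2))
      (simp add: tensor_elt3_def t1(2) t2(2) el dual_mult_tensor_elt id_hom_apply)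
  have "associator R D ?\<mu> (tensor_elt3 R D f g h) m = tensor_functional3 f g h ?l \<ominus>\<^bsub>Reg\<^esub> tensor_functional3 f g h ?r"
    unfolding eq using convolution_closed[OF c(1) h] convolution_closed[OF f c(2)] m
    by (simp add: carrier_dual hom_module_minus[OF M module_reg, folded dual_module_def]
        convolution_convolution_left[OF f g h] convolution_convolution_right[OF f g h])
  also have "\<dots> = tensor_functional3 f g h (coassociator R M \<Delta> m)"
    by (simp only: coassociator(2)[OF m] lin_hom_minus[OF module_tensor_cube[OF M] module_reg tensor_functional3(1)[OF f g h] lr])
  finally show "associator R D ?\<mu> (tensor_elt3 R D f g h) m = tensor_functional3 f g h (coassociator R M \<Delta> m)" .
qed

text \<open>On pure tensors this reindexes a product of three scalars:
  \<open>f (inv \<sigma> j)\<close> applied to the entry at \<open>j\<close> becomes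
  \<open>f k\<close> applied to the entry at \<open>\<sigma> k\<close>. Commutativity of
  \<open>R\<close> permits the reordering.\<close>

lemma tensor_functional3_permute:
  assumes f: "\<And>j. j \<in> {1, 2, 3::nat} \<Longrightarrow> f j \<in> carrier D" and \<sigma>: "\<sigma> permutes {1, 2, 3}"
    and t: "t \<in> carrier (tensor_cube R M)"
  shows "tensor_functional3 (f (inv_into UNIV \<sigma> 1)) (f (inv_into UNIV \<sigma> 2)) (f (inv_into UNIV \<sigma> 3)) t =
    tensor_functional3 (f 1) (f 2) (f 3) (Phi R M (inv_into UNIV \<sigma>) t)"
proof -
  interpret cring R by (rule cring)
  let ?C = "tensor_cube R M" and ?i = "inv_into UNIV \<sigma>"
  note i = permutes_inv[OF \<sigma>]
  have fi: "f (?i j) \<in> carrier D" if "j \<in> {1, 2, 3}" for j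
    using f permutes_in_image[OF i] that by blast
  have f123: "f 1 \<in> carrier D" "f 2 \<in> carrier D" "f 3 \<in> carrier D"
    and fi123: "f (?i 1) \<in> carrier D" "f (?i 2) \<in> carrier D" "f (?i 3) \<in> carrier D"
    by (intro f fi; simp)+
  have cl: "f j x \<in> carrier R" if "j \<in> {1, 2, 3}" "x \<in> carrier M" for j x
    using lin_hom_closed[of "f j" R M Reg x] f[of j] that by (simp add: carrier_dual)
  have "tensor_functional3 (f (?i 1)) (f (?i 2)) (f (?i 3)) =
    compose (carrier ?C) (tensor_functional3 (f 1) (f 2) (f 3)) (Phi R M ?i)"
  proof (rule cube_hom_eqI[OF M module_reg])
    show "tensor_functional3 (f (?i 1)) (f (?i 2)) (f (?i 3)) \<in> lin_hom R ?C Reg"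
      using fi123 by (rule tensor_functional3(1))
    show "compose (carrier ?C) (tensor_functional3 (f 1) (f 2) (f 3)) (Phi R M ?i) \<in> lin_hom R ?C Reg"
      using lin_hom_compose[OF module_tensor_cube[OF M] Phi(1)[OF M i] tensor_functional3(1)[OF f123]] .
  next
    fix x y z assume xyz: "x \<in> carrier M" "y \<in> carrier M" "z \<in> carrier M"
    define v where "v = (\<lambda>j::nat. if j = 1 then x else if j = 2 then y else z)"
    have v: "v j \<in> carrier M" for j using xyz by (simp add: v_def)
    have v123: "v 1 = x" "v 2 = y" "v 3 = z" by (simp_all add: v_def)
    \<comment> \<open>\<open>Phi\<close> already inverts its permutation, so at the inverse of
      \<open>\<sigma>\<close> the entries are permuted by \<open>\<sigma>\<close> itself.\<close>
    have Phi: "Phi R M ?i (tensor_elt3 R M x y z) = tensor_elt3 R M (v (\<sigma> 1)) (v (\<sigma> 2)) (v (\<sigma> 3))"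
      using Phi(2)[OF M i, of v, OF v] by (simp only: v123 permutes_inv_inv[OF \<sigma>])
    have "?i (\<sigma> j) = j" for j using permutes_inverses(2)[OF \<sigma>] .
    \<comment> \<open>In each of the six cases for \<open>\<sigma>\<close> the cancellation
      equations supply the values of its inverse at 1, 2 and 3; the two products then differ only in
      order.\<close>
    from this[of 1] this[of 2] this[of 3] permutes_123_cases[OF \<sigma>]
    have "f (?i 1) (v 1) \<otimes>\<^bsub>R\<^esub> f (?i 2) (v 2) \<otimes>\<^bsub>R\<^esub> f (?i 3) (v 3) =
      f 1 (v (\<sigma> 1)) \<otimes>\<^bsub>R\<^esub> f 2 (v (\<sigma> 2)) \<otimes>\<^bsub>R\<^esub> f 3 (v (\<sigma> 3))"
      by (elim insertE emptyE; simp add: cl[simplified] v m_ac)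
    then show "tensor_functional3 (f (?i 1)) (f (?i 2)) (f (?i 3)) (tensor_elt3 R M x y z) =
        compose (carrier ?C) (tensor_functional3 (f 1) (f 2) (f 3)) (Phi R M ?i) (tensor_elt3 R M x y z)"
      using xyz by (simp only: tensor_functional3(2)[OF f123] tensor_functional3(2)[OF fi123] v Phi
          compose_eq tensor_elt3_closed[OF M] v123)
  qed
  then show ?thesis using t by (simp only: compose_eq)
qed

text \<open>The required equation is tested on a pure tensor of functionals and then at a single
  \<open>m\<close>, which turns it into an equation in \<open>R\<close>. There the algebra sum and
  the coalgebra sum can be matched term by term after reindexing.\<close>

lemma dual_mult_G_associative:
  assumes "G_coalgebra R i M \<Delta>"
  shows "G_associative_algebra R i D (dual_mult R M \<Delta>)"
proof -
  let ?C = "tensor_cube R M" and ?CD = "tensor_cube R D"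
  let ?A = "associator R D (dual_mult R M \<Delta>)" and ?inv = "inv_into UNIV :: (nat \<Rightarrow> nat) \<Rightarrow> nat \<Rightarrow> nat"
  note C = module_tensor_cube[OF M] and CD = module_tensor_cube[OF module_dual]
  note group = module.axioms(2)
  have PhiD: "Phi R D \<in> sub_S3 i \<rightarrow> carrier (hom_module R ?CD ?CD)"
    using Phi(1)[OF module_dual sub_S3_permutes] by simp
  have Psi: "(\<lambda>\<sigma>. compose (carrier M) (Phi R M \<sigma>) (coassociator R M \<Delta>)) \<in> sub_S3 i \<rightarrow> carrier (hom_module R M ?C)"
    using lin_hom_compose[OF M coassociator(1) Phi(1)[OF M sub_S3_permutes]] by simp
  note sum = Phi_sum_lin[OF module_dual, of i]
  have "compose (carrier ?CD) ?A (Phi_sum R D i) = \<zero>\<^bsub>hom_module R ?CD D\<^esub>"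
  proof (rule cube_hom_eqI[OF module_dual module_dual])
    show "compose (carrier ?CD) ?A (Phi_sum R D i) \<in> lin_hom R ?CD D"
      using lin_hom_compose[OF CD sum associator_dual_mult(1)] .
    show "\<zero>\<^bsub>hom_module R ?CD D\<^esub> \<in> lin_hom R ?CD D" using lin_hom_hom_zero[OF CD module_dual] .
  next
    fix f1 f2 f3 assume f123: "f1 \<in> carrier D" "f2 \<in> carrier D" "f3 \<in> carrier D"
    define f where "f = (\<lambda>j::nat. if j = 1 then f1 else if j = 2 then f2 else f3)"
    have f: "f j \<in> carrier D" for j using f123 by (simp add: f_def)
    have f_simps: "f 1 = f1" "f 2 = f2" "f 3 = f3" by (simp_all add: f_def)
    let ?t = "tensor_elt3 R D f1 f2 f3" and ?tf = "tensor_functional3 f1 f2 f3"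
    have t: "?t \<in> carrier ?CD" using tensor_elt3_closed[OF module_dual f123] .
    note tf = tensor_functional3(1)[OF f123]
    have At: "?A (\<Psi> ?t) \<in> lin_hom R M Reg" if "\<Psi> \<in> lin_hom R ?CD ?CD" for \<Psi>
      using lin_hom_closed[OF associator_dual_mult(1) lin_hom_closed[OF that t]] by (simp add: carrier_dual)
    have "?A (Phi_sum R D i ?t) = \<zero>\<^bsub>D\<^esub>"
    proof (rule lin_hom_eqI)
      show "?A (Phi_sum R D i ?t) \<in> lin_hom R M Reg" using At[OF sum] .
      show "\<zero>\<^bsub>D\<^esub> \<in> lin_hom R M Reg"
        unfolding dual_module_def using lin_hom_hom_zero[OF M module_reg] .
    next
      fix m assume m: "m \<in> carrier M"
      let ?w = "coassociator R M \<Delta> m"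
      have w: "?w \<in> carrier ?C" using lin_hom_closed[OF coassociator(1) m] .
      \<comment> \<open>Two additive evaluations into \<open>R\<close>: \<open>?h\<close> reads off
        the algebra side from endomorphisms of the dual cube, \<open>?k\<close> the coalgebra side
        from maps of \<open>M\<close> into its cube.\<close>
      let ?h = "\<lambda>\<Psi>. ?A (\<Psi> ?t) m" and ?k = "\<lambda>\<Psi>. ?tf (\<Psi> m)"
      let ?K = "\<lambda>\<sigma>. ?tf (Phi R M \<sigma> ?w)"
      have K: "?K \<sigma> \<in> carrier Reg" if "\<sigma> \<in> sub_S3 i" for \<sigma>
        using lin_hom_closed[OF tf lin_hom_closed[OF Phi(1)[OF M sub_S3_permutes[OF that]] w]] .
      have hPhi: "?h (Phi R D \<sigma>) = ?K (?inv \<sigma>)" if "\<sigma> \<in> sub_S3 i" for \<sigma>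
      proof -
        note p = sub_S3_permutes[OF that]
        have "Phi R D \<sigma> ?t = tensor_elt3 R D (f (?inv \<sigma> 1)) (f (?inv \<sigma> 2)) (f (?inv \<sigma> 3))"
          using Phi(2)[OF module_dual p, of f, OF f] by (simp only: f_simps)
        then show ?thesis
          using tensor_functional3_permute[of f, OF f p w] by (simp only: associator_dual_mult(2) f m f_simps)
      qed
      have "?h (Phi_sum R D i) = (\<Oplus>\<^bsub>Reg\<^esub>\<sigma>\<in>sub_S3 i. add_pow Reg (sign \<sigma>) (?h (Phi R D \<sigma>)))"
        unfolding Phi_sum_def
      proof (rule additive_signed_sum[OF group[OF module_hom_module[OF CD CD]] group[OF module_reg] _ _ PhiD finite_sub_S3])
        show "?h \<in> carrier (hom_module R ?CD ?CD) \<rightarrow> carrier Reg"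
          using lin_hom_closed[OF At m] by auto
        show "?h (\<Psi> \<oplus>\<^bsub>hom_module R ?CD ?CD\<^esub> \<Psi>') = ?h \<Psi> \<oplus>\<^bsub>Reg\<^esub> ?h \<Psi>'"
          if "\<Psi> \<in> carrier (hom_module R ?CD ?CD)" "\<Psi>' \<in> carrier (hom_module R ?CD ?CD)" for \<Psi> \<Psi>'
          using that lin_hom_closed[OF that(1)[simplified] t] lin_hom_closed[OF that(2)[simplified] t]
          by (simp add: hom_module_add t m lin_hom_add[OF associator_dual_mult(1)]
              hom_module_add[of m M R Reg, folded dual_module_def])
      qed
      \<comment> \<open>By \<open>hPhi\<close> each summand is \<open>?K\<close> at the inverse
        permutation, so inversion of the index set applies.\<close>
      also have "\<dots> = (\<Oplus>\<^bsub>Reg\<^esub>\<sigma>\<in>sub_S3 i. add_pow Reg (sign \<sigma>) (?K \<sigma>))"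
        using K hPhi by (intro signed_sum_inverse[OF group[OF module_reg]]) auto
      also have "\<dots> =
          (\<Oplus>\<^bsub>Reg\<^esub>\<sigma>\<in>sub_S3 i. add_pow Reg (sign \<sigma>) (?k (compose (carrier M) (Phi R M \<sigma>) (coassociator R M \<Delta>))))"
        by (simp add: compose_eq m)
      \<comment> \<open>Additivity of \<open>?k\<close> is read backwards to collect the scalars
        into the sum of maps that the coalgebra condition sets to zero.\<close>
      also have "\<dots> = ?k (\<Oplus>\<^bsub>hom_module R M ?C\<^esub>\<sigma>\<in>sub_S3 i. add_pow (hom_module R M ?C) (sign \<sigma>)
          (compose (carrier M) (Phi R M \<sigma>) (coassociator R M \<Delta>)))"
      proof (rule additive_signed_sum[OF group[OF module_hom_module[OF M C]] group[OF module_reg] _ _ Psi finite_sub_S3, symmetric])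
        show "?k \<in> carrier (hom_module R M ?C) \<rightarrow> carrier Reg"
          using lin_hom_closed[OF tf] lin_hom_closed[OF _ m] by auto
        show "?k (\<Psi> \<oplus>\<^bsub>hom_module R M ?C\<^esub> \<Psi>') = ?k \<Psi> \<oplus>\<^bsub>Reg\<^esub> ?k \<Psi>'"
          if "\<Psi> \<in> carrier (hom_module R M ?C)" "\<Psi>' \<in> carrier (hom_module R M ?C)" for \<Psi> \<Psi>'
          using that lin_hom_closed[OF that(1)[simplified] m] lin_hom_closed[OF that(2)[simplified] m]
          by (simp add: hom_module_add m lin_hom_add[OF tf])
      qed
      also have "\<dots> = ?k \<zero>\<^bsub>hom_module R M ?C\<^esub>"
        using assms unfolding G_coalgebra_def by simp
      also have "\<dots> = \<zero>\<^bsub>Reg\<^esub>"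
        using lin_hom_zero[OF C module_reg tf] by (simp add: hom_module_zero m)
      finally show "?A (Phi_sum R D i ?t) m = \<zero>\<^bsub>D\<^esub> m"
        by (simp add: dual_module_def hom_module_zero m)
    qed
    then show "compose (carrier ?CD) ?A (Phi_sum R D i) ?t = \<zero>\<^bsub>hom_module R ?CD D\<^esub> ?t"
      by (simp add: compose_eq t hom_module_zero)
  qed
  then show ?thesis
    unfolding G_associative_algebra_def using module_dual dual_mult_lin by (simp add: tensor_square_def)
qed

end

text \<open>The second conjunct ties the definite description \<open>dual_mult\<close> to the
  prescribed formula on pure tensors, so that the associativity claim concerns the intended
  multiplication.\<close>

theorem proposition5:
  fixes R :: "('r, 'x) ring_scheme"
    and M :: "('r, 'm, 'y) module_scheme"
    and \<Delta> :: "'m \<Rightarrow> ('m \<times> 'm \<Rightarrow> 'r) set"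
    and i :: nat
  assumes "cring R"
    and "i \<in> {1..6}"
    and "G_coalgebra R i M \<Delta>"
  shows "G_associative_algebra R i (dual_module R M) (dual_mult R M \<Delta>) \<and>
    (\<forall>f\<^sub>1\<in>carrier (dual_module R M). \<forall>f\<^sub>2\<in>carrier (dual_module R M).
       dual_mult R M \<Delta> (tensor_elt R (dual_module R M) (dual_module R M) f\<^sub>1 f\<^sub>2) =
         compose (carrier M) (mult_map R)
           (compose (carrier M)
             (lambda2 R M (tensor_elt R (dual_module R M) (dual_module R M) f\<^sub>1 f\<^sub>2)) \<Delta>))"
proof -
  have "module R M" "\<Delta> \<in> lin_hom R M (tensor_square R M)"
    using assms(3) unfolding G_coalgebra_def by auto
  note coalgebra = assms(1) this
  show ?thesis
    using dual_mult_G_associative[OF coalgebra assms(3)] dual_mult_tensor_elt[OF coalgebra]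
    by (simp add: convolution_def)
qed

end
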